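(* For every bounded derivative property $\mathcal{P}$ of real-valued functions on the hypergrid $[n]^d$, there exists a one-sided error $\alpha$-erasure-resilient $\varepsilon$-tester for $\mathcal{P}$ that works for all $\alpha,\varepsilon\in(0,1)$ with $\alpha\le\varepsilon/(970d)$, with query complexity $O\!\left(\frac{d\log n}{\varepsilon(1-\alpha)}\right)$.
   Context: Erasure-resilient testing: for a domain $\mathcal{D}$ and $\alpha\in(0,1)$, a function $f:\mathcal{D}\to\mathbb{R}\cup\{\perp\}$ is $\alpha$-erased if it equals $\perp$ (erased) on at most an $\alpha$ fraction of $\mathcal{D}$; $\mathcal{N}$ is the set of nonerased points; a restoration is any $f':\mathcal{D}\to\mathbb{R}$ agreeing with $f$ on $\mathcal{N}$. An $\alpha$-erasure-resilient $\varepsilon$-tester for $\mathcal{P}$, given $\alpha,\varepsilon$ and query access to an $\alpha$-erased $f$ (queries return $f(x)$ or $\perp$; $\mathcal{N}$ is unknown in advance), must with probability at least $2/3$ accept if some restoration satisfies $\mathcal{P}$ and reject if every restoration must be changed on at least an $\varepsilon$ fraction of $\mathcal{N}$ to satisfy $\mathcal{P}$; one-sided error means acceptance with probability 1 in the first case; query complexity is worst case. Hypergrid: $[n]^d$ with partial order $x\preceq y$ iff $x_i\le y_i$ for all $i$. Bounded derivative properties: a bounding family is $\mathbf{B}=(l_1,u_1,\dots,l_d,u_d)$ with $l_r,u_r:[n-1]\to\mathbb{R}\cup\{\pm\infty\}$ and $l_r(y)<u_r(y)$ for all $r,y$. It defines $\mathfrak{m}_{\mathbf{B}}(x,y)=\sum_{r:x_r>y_r}\sum_{t=y_r}^{x_r-1}u_r(t)-\sum_{r:x_r<y_r}\sum_{t=x_r}^{y_r-1}l_r(t)$.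 For $\mathcal{D}\subseteq[n]^d$, $f:\mathcal{D}\to\mathbb{R}$ has property $\mathcal{P}(\mathbf{B})$ iff $f(x)-f(y)\le\mathfrak{m}_{\mathbf{B}}(x,y)$ for all $x,y\in\mathcal{D}$ (on $[n]^d$ this is equivalent to $l_r(x_r)\le f(x+e_r)-f(x)\le u_r(x_r)$ for all $r$ and $x$ with $x_r\ne n$). A bounded derivative property is $\mathcal{P}(\mathbf{B})$ for some bounding family $\mathbf{B}$; examples include monotonicity and the $c$-Lipschitz property. *)

theory Defs
  imports "HOL-Probability.Probability"
begin

text \<open>
  Points of \<open>[n]\<^sup>d\<close> are extensional functions \<open>x :: nat \<Rightarrow> nat\<close> with coordinates \<open>x 1, \<dots>, x d\<close>
  in \<open>{1..n}\<close>.
\<close>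

definition hypergrid :: "nat \<Rightarrow> nat \<Rightarrow> (nat \<Rightarrow> nat) set" where
  "hypergrid n d = {1..d} \<rightarrow>\<^sub>E {1..n}"

text \<open>
  A bounding family is given by \<open>l\<close> and \<open>u\<close>, where \<open>l r t\<close> and \<open>u r t\<close> are the lower and upper
  bounds along dimension \<open>r\<close> at position \<open>t \<in> [n-1]\<close>.
\<close>

definition bounding_family ::
    "nat \<Rightarrow> nat \<Rightarrow> (nat \<Rightarrow> nat \<Rightarrow> ereal) \<Rightarrow> (nat \<Rightarrow> nat \<Rightarrow> ereal) \<Rightarrow> bool" where
  "bounding_family n d l u \<longleftrightarrow> (\<forall>r\<in>{1..d}. \<forall>t\<in>{1..<n}. l r t < u r t)"

text \<open>
  For a bounding family every \<open>u r t\<close> exceeds \<open>-\<infinity>\<close> and every \<open>l r t\<close> is below \<open>\<infinity>\<close>, so on the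
  hypergrid the expression below never contains an undefined form \<open>\<infinity> - \<infinity>\<close>.
\<close>

definition bounding_dist ::
    "nat \<Rightarrow> (nat \<Rightarrow> nat \<Rightarrow> ereal) \<Rightarrow> (nat \<Rightarrow> nat \<Rightarrow> ereal) \<Rightarrow> (nat \<Rightarrow> nat) \<Rightarrow> (nat \<Rightarrow> nat) \<Rightarrow> ereal" where
  "bounding_dist d l u x y =
     (\<Sum>r\<in>{r\<in>{1..d}. x r > y r}. \<Sum>t\<in>{y r..<x r}. u r t)
   - (\<Sum>r\<in>{r\<in>{1..d}. x r < y r}. \<Sum>t\<in>{x r..<y r}. l r t)"

text \<open>
  A property of functions \<open>D \<rightarrow> \<real>\<close> is a set of total functions; only their values on \<open>D\<close> matter.
\<close>

definition bounded_derivative ::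
    "nat \<Rightarrow> (nat \<Rightarrow> nat \<Rightarrow> ereal) \<Rightarrow> (nat \<Rightarrow> nat \<Rightarrow> ereal) \<Rightarrow> (nat \<Rightarrow> nat) set
      \<Rightarrow> ((nat \<Rightarrow> nat) \<Rightarrow> real) set" where
  "bounded_derivative d l u D =
     {f. \<forall>x\<in>D. \<forall>y\<in>D. ereal (f x - f y) \<le> bounding_dist d l u x y}"

definition bounded_derivative_property ::
    "nat \<Rightarrow> nat \<Rightarrow> ((nat \<Rightarrow> nat) \<Rightarrow> real) set \<Rightarrow> bool" where
  "bounded_derivative_property n d P \<longleftrightarrow>
     (\<exists>l u. bounding_family n d l u \<and> P = bounded_derivative d l u (hypergrid n d))"

text \<open>Partially erased functions; \<open>None\<close> plays the role of the erasure symbol.\<close>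

definition nonerased :: "'a set \<Rightarrow> ('a \<Rightarrow> real option) \<Rightarrow> 'a set" where
  "nonerased D f = {x\<in>D. f x \<noteq> None}"

definition erased :: "'a set \<Rightarrow> real \<Rightarrow> ('a \<Rightarrow> real option) \<Rightarrow> bool" where
  "erased D \<alpha> f \<longleftrightarrow> real (card {x\<in>D. f x = None}) \<le> \<alpha> * real (card D)"

definition restoration :: "'a set \<Rightarrow> ('a \<Rightarrow> real option) \<Rightarrow> ('a \<Rightarrow> real) \<Rightarrow> bool" where
  "restoration D f f' \<longleftrightarrow> (\<forall>x\<in>nonerased D f. f x = Some (f' x))"

definition restorable ::
    "'a set \<Rightarrow> ('a \<Rightarrow> real) set \<Rightarrow> ('a \<Rightarrow> real option) \<Rightarrow> bool" where
  "restorable D P f \<longleftrightarrow> (\<exists>f'. restoration D f f' \<and> f' \<in> P)"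

definition far ::
    "'a set \<Rightarrow> ('a \<Rightarrow> real) set \<Rightarrow> real \<Rightarrow> ('a \<Rightarrow> real option) \<Rightarrow> bool" where
  "far D P \<epsilon> f \<longleftrightarrow>
     (\<forall>f'. restoration D f f' \<longrightarrow>
        (\<forall>g\<in>P. real (card {x\<in>nonerased D f. f' x \<noteq> g x}) \<ge> \<epsilon> * real (card (nonerased D f))))"

text \<open>
  A deterministic adaptive query algorithm is a decision tree whose next step may depend on the
  answers received so far. A randomized algorithm is a probability distribution over such trees.
\<close>

datatype (query_points: 'a) query_alg =
    Decide bool
  | Query 'a "real option \<Rightarrow> 'a query_alg"

primrec accepts :: "'a query_alg \<Rightarrow> ('a \<Rightarrow> real option) \<Rightarrow> bool" where
  "accepts (Decide b) f = b"
| "accepts (Query x k) f = accepts (k (f x)) f"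

primrec num_queries :: "'a query_alg \<Rightarrow> ('a \<Rightarrow> real option) \<Rightarrow> nat" where
  "num_queries (Decide b) f = 0"
| "num_queries (Query x k) f = Suc (num_queries (k (f x)) f)"

definition erasure_resilient_tester ::
    "'a set \<Rightarrow> ('a \<Rightarrow> real) set \<Rightarrow> real \<Rightarrow> real \<Rightarrow> 'a query_alg pmf \<Rightarrow> bool" where
  "erasure_resilient_tester D P \<alpha> \<epsilon> T \<longleftrightarrow>
     (\<forall>A\<in>set_pmf T. query_points A \<subseteq> D) \<and>
     (\<forall>f. erased D \<alpha> f \<longrightarrow>
        (restorable D P f \<longrightarrow> measure_pmf.prob T {A. accepts A f} \<ge> 2/3) \<and>
        (far D P \<epsilon> f \<longrightarrow> measure_pmf.prob T {A. \<not> accepts A f} \<ge> 2/3))"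

definition one_sided_error ::
    "'a set \<Rightarrow> ('a \<Rightarrow> real) set \<Rightarrow> real \<Rightarrow> 'a query_alg pmf \<Rightarrow> bool" where
  "one_sided_error D P \<alpha> T \<longleftrightarrow>
     (\<forall>f. erased D \<alpha> f \<longrightarrow> restorable D P f \<longrightarrow> measure_pmf.prob T {A. accepts A f} = 1)"

text \<open>Worst case over all \<open>\<alpha>\<close>-erased inputs and all random choices of the algorithm.\<close>

definition query_complexity_le ::
    "'a set \<Rightarrow> real \<Rightarrow> 'a query_alg pmf \<Rightarrow> real \<Rightarrow> bool" where
  "query_complexity_le D \<alpha> T q \<longleftrightarrow>
     (\<forall>f. erased D \<alpha> f \<longrightarrow> (\<forall>A\<in>set_pmf T. real (num_queries A f) \<le> q))"

end

theory Submission
  imports Defs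
begin

text \<open>
  Weight an ordered pair \<open>(x, y)\<close> by \<open>f x - f y - m x y\<close> and take a partial injection of
  maximum weight and, subject to that, minimum cardinality \<open>c\<^sub>r\<close> among the pairs that agree in the
  coordinates \<open>1, \<dots>, r\<close>.  The endpoints of an optimal one for \<open>r = 0\<close> cover all violations, and
  \<open>c\<^sub>d = 0\<close>.  If \<open>f\<close> has no violation on a line in direction \<open>r\<close>, exchanges along alternating
  paths remove all pairs crossing direction \<open>r\<close>, so \<open>c\<^bsub>r-1\<^esub> = c\<^sub>r\<close>; and changing \<open>f\<close> at one point
  changes \<open>c\<^sub>r\<close> by at most two.  Hence if deleting \<open>X\<^sub>r\<close> removes all violations on lines in direction
  \<open>r\<close>, then \<open>c\<^bsub>r-1\<^esub> \<le> c\<^sub>r + 4 |X\<^sub>r|\<close>, and \<open>f\<close> is within Hamming distance \<open>8 \<Sum>\<^sub>r |X\<^sub>r|\<close> of the property.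

  On a single line, let \<open>i < j\<close> be a violated pair.  Every nonerased point between them violates with \<open>i\<close> or with \<open>j\<close>,
  so unless half of the interval is erased, one of the two violates with a constant fraction of the
  points within distance \<open>2\<^sup>k\<close> on one side, where \<open>2\<^sup>k\<close> is about \<open>j - i\<close>.  A maximal inequality
  shows that only \<open>O(|erased|)\<close> points are endpoints of an interval that is half erased.  So comparing a
  random point with a random point at a random dyadic scale in a random direction detects a violation
  with probability \<open>\<Omega>(\<epsilon> / (d log n))\<close>, and the tester repeats this independently.
\<close>

section \<open>Optimal matchings\<close>

text \<open>When both types coincide, left and right endpoints act as two copies of the vertex set:
  a point may occur once in each role, and a loop \<open>(x, x)\<close> is an admissible
  edge.\<close>

definition matching :: "('a \<times> 'b) set \<Rightarrow> ('a \<times> 'b) set \<Rightarrow> bool" where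
  "matching Q M \<longleftrightarrow> M \<subseteq> Q \<and> single_valued M \<and> single_valued (M\<inverse>)"

definition weight :: "('a \<Rightarrow> 'b \<Rightarrow> real) \<Rightarrow> ('a \<times> 'b) set \<Rightarrow> real" where
  "weight w M = (\<Sum>e\<in>M. w (fst e) (snd e))"

text \<open>The tie-break by cardinality discards edges of weight zero, such as the loops
  \<open>(x, x)\<close> below, and makes the cardinality of an optimal matching an invariant of the
  weights.\<close>

definition optimal :: "('a \<times> 'b) set \<Rightarrow> ('a \<Rightarrow> 'b \<Rightarrow> real) \<Rightarrow> ('a \<times> 'b) set \<Rightarrow> bool" where
  "optimal Q w M \<longleftrightarrow> matching Q M \<and>
     (\<forall>M'. matching Q M' \<longrightarrow> weight w M' < weight w M \<or> weight w M' = weight w M \<and> card M \<le> card M')"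

definition opt_card :: "('a \<times> 'b) set \<Rightarrow> ('a \<Rightarrow> 'b \<Rightarrow> real) \<Rightarrow> nat" where
  "opt_card Q w = card (SOME M. optimal Q w M)"

lemma matchingD:
  assumes "matching Q M"
  shows "M \<subseteq> Q" "(x, y) \<in> M \<Longrightarrow> (x, y') \<in> M \<Longrightarrow> y = y'" "(x, y) \<in> M \<Longrightarrow> (x', y) \<in> M \<Longrightarrow> x = x'"
proof -
  show "M \<subseteq> Q" using assms by (simp add: matching_def)
  show "y = y'" if "(x, y) \<in> M" "(x, y') \<in> M"
    using single_valuedD[OF _ that] assms by (simp add: matching_def)
  show "x = x'" if "(x, y) \<in> M" "(x', y) \<in> M"
    using single_valuedD[of "M\<inverse>" y x x'] that assms by (simp add: matching_def)
qed

lemma matchingI: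
  assumes "M \<subseteq> Q" "\<And>x y y'. (x, y) \<in> M \<Longrightarrow> (x, y') \<in> M \<Longrightarrow> y = y'"
    "\<And>x x' y. (x, y) \<in> M \<Longrightarrow> (x', y) \<in> M \<Longrightarrow> x = x'"
  shows "matching Q M"
  unfolding matching_def
proof (intro conjI single_valuedI)
  show "M \<subseteq> Q" by (rule assms(1))
qed (use assms(2,3) in auto)

lemma optimal_exists:
  assumes "finite Q"
  shows "\<exists>M. optimal Q w M"
proof -
  let ?\<M> = "{M. matching Q M}"
  have fin: "finite ?\<M>"
    by (rule finite_subset[OF _ finite_Pow_iff[THEN iffD2, OF assms]]) (auto simp: matching_def)
  have ne: "{} \<in> ?\<M>" by (simp add: matching_def)
  define W where "W = Max (weight w ` ?\<M>)"
  have "W \<in> weight w ` ?\<M>" unfolding W_def using fin ne by (intro Max_in) auto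
  then obtain M0 where M0: "matching Q M0 \<and> weight w M0 = W" by auto
  define M where "M = arg_min card (\<lambda>M. matching Q M \<and> weight w M = W)"
  have M: "matching Q M" "weight w M = W"
    using arg_min_natI[where P = "\<lambda>M. matching Q M \<and> weight w M = W", OF M0, of card]
    by (auto simp: M_def)
  have "weight w M' < weight w M \<or> weight w M' = weight w M \<and> card M \<le> card M'"
    if "matching Q M'" for M'
  proof -
    have "weight w M' \<le> W" unfolding W_def using fin that by (intro Max_ge) auto
    moreover have "card M \<le> card M'" if "weight w M' = W"
      unfolding M_def using \<open>matching Q M'\<close> that by (intro arg_min_nat_le) auto
    ultimately show ?thesis using M by force
  qed
  then show ?thesis using M by (auto simp: optimal_def)
qed

lemma optimal_card_unique:
  assumes M: "optimal Q w M" and M': "optimal Q w M'"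
  shows "card M = card M'"
proof -
  have "weight w M' < weight w M \<or> weight w M' = weight w M \<and> card M \<le> card M'"
    using M M' by (simp add: optimal_def)
  moreover have "weight w M < weight w M' \<or> weight w M = weight w M' \<and> card M' \<le> card M"
    using M M' by (simp add: optimal_def)
  ultimately show ?thesis by linarith
qed

lemma opt_card_eqI:
  assumes "optimal Q w M"
  shows "opt_card Q w = card M"
  unfolding opt_card_def by (rule optimal_card_unique[OF someI[of "optimal Q w", OF assms] assms])

lemma weight_Un:
  assumes "finite A" "finite B" "A \<inter> B = {}"
  shows "weight w (A \<union> B) = weight w A + weight w B"
  using assms by (simp add: weight_def sum.union_disjoint)

lemma card_Domain_single_valued:
  assumes "single_valued M"
  shows "card (Domain M) = card M"
proof -
  have "inj_on fst M" using assms by (auto simp: inj_on_def single_valued_def)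
  then show ?thesis by (simp add: card_image flip: fst_eq_Domain)
qed

text \<open>
  The alternating path of \<open>M\<close> and \<open>M'\<close> through \<open>u\<close> is left alone, and the two matchings are
  exchanged off it, where \<open>w\<close> and \<open>w'\<close> agree; on a path the two cardinalities differ by at most one.
\<close>

lemma optimal_card_row_change:
  assumes fin: "finite Q" and M: "optimal Q w M" and M': "optimal Q w' M'"
    and agree: "\<And>x y. x \<noteq> u \<Longrightarrow> w x y = w' x y"
  shows "card M \<le> card M' + 1"
proof -
  have mM: "matching Q M" and mM': "matching Q M'" using M M' by (auto simp: optimal_def)
  have finM: "finite M" "finite M'"
    using mM mM' fin by (auto simp: matching_def intro: finite_subset)
  \<comment> \<open>\<open>T\<close> links left endpoints \<open>p\<close>, \<open>q\<close> whose
    \<open>M\<close>-edge and \<open>M'\<close>-edge share a right endpoint; following it traces the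
    alternating paths, seen from the left side only.\<close>
  define T where "T = M O M'\<inverse>"
  have svT: "single_valued T" using mM mM' by (auto simp: T_def matching_def intro: single_valued_relcomp)
  have svT': "single_valued (T\<inverse>)"
    using mM mM' by (auto simp: T_def matching_def converse_relcomp intro: single_valued_relcomp)
  \<comment> \<open>The left endpoints on the path of \<open>u\<close>, in both directions; as
    \<open>T\<close> is injective and single valued, \<open>R\<close> is closed under
    \<open>T\<close> and its converse.\<close>
  define R where "R = {p. (u, p) \<in> T\<^sup>* \<or> (p, u) \<in> T\<^sup>*}"
  have fwd: "q \<in> R" if "p \<in> R" "(p, q) \<in> T" for p q
  proof -
    consider "(u, p) \<in> T\<^sup>*" | "p = u" | z where "(p, z) \<in> T" "(z, u) \<in> T\<^sup>*"
      using \<open>p \<in> R\<close> unfolding R_def by (auto elim: converse_rtranclE)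
    then show ?thesis
    proof cases
      case 1 then show ?thesis using that by (auto simp: R_def)
    next
      case 2 then show ?thesis using that by (auto simp: R_def)
    next
      case 3 then show ?thesis using that svT by (auto simp: R_def single_valued_def)
    qed
  qed
  have bwd: "p \<in> R" if "q \<in> R" "(p, q) \<in> T" for p q
  proof -
    consider "(q, u) \<in> T\<^sup>*" | "q = u" | z where "(z, q) \<in> T" "(u, z) \<in> T\<^sup>*"
      using \<open>q \<in> R\<close> unfolding R_def by (auto elim: rtranclE)
    then show ?thesis
    proof cases
      case 1 then show ?thesis using that by (auto simp: R_def intro: converse_rtrancl_into_rtrancl)
    next
      case 2 then show ?thesis using that by (auto simp: R_def)
    next
      case 3
      then have "z = p" using that svT' by (auto simp: single_valued_def)
      then show ?thesis using 3 by (simp add: R_def)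
    qed
  qed
  have uR: "u \<in> R" by (simp add: R_def)
  have noT: "p \<in> R \<longleftrightarrow> q \<in> R" if "(p, v) \<in> M" "(q, v) \<in> M'" for p q v
    using that fwd[of p q] bwd[of q p] by (auto simp: T_def)
  define MR where "MR = {e\<in>M. fst e \<in> R}"
  define MC where "MC = {e\<in>M. fst e \<notin> R}"
  define MR' where "MR' = {e\<in>M'. fst e \<in> R}"
  define MC' where "MC' = {e\<in>M'. fst e \<notin> R}"
  note defs = MR_def MC_def MR'_def MC'_def
  have split: "M = MR \<union> MC" "MR \<inter> MC = {}" "M' = MR' \<union> MC'" "MR' \<inter> MC' = {}"
    "MR \<inter> MC' = {}" "MR' \<inter> MC = {}"
    by (auto simp: defs)
  have fins: "finite MR" "finite MC" "finite MR'" "finite MC'" using finM by (auto simp: defs)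
  \<comment> \<open>By \<open>noT\<close>, an edge of one matching inside \<open>R\<close> and an
    edge of the other outside \<open>R\<close> never share a right endpoint, so both hybrids are
    matchings.\<close>
  have N1: "matching Q (MR \<union> MC')"
    using matchingD[OF mM] matchingD[OF mM'] noT by (intro matchingI) (auto simp: defs)
  have N2: "matching Q (MR' \<union> MC)"
    using matchingD[OF mM] matchingD[OF mM'] noT by (intro matchingI) (auto simp: defs)
  have eqw: "weight w A = weight w' A" if "A = MC \<or> A = MC'" for A
    unfolding weight_def
  proof (intro sum.cong refl)
    fix e assume "e \<in> A"
    then have "fst e \<noteq> u" using that uR by (auto simp: defs)
    then show "w (fst e) (snd e) = w' (fst e) (snd e)" by (rule agree)
  qed
  have 1: "weight w (MR \<union> MC') < weight w M \<or> weight w (MR \<union> MC') = weight w M \<and> card M \<le> card (MR \<union> MC')"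
    using M N1 by (auto simp: optimal_def)
  have 2: "weight w' (MR' \<union> MC) \<le> weight w' M'"
    using M' N2 by (auto simp: optimal_def)
  have w1: "weight w (MR \<union> MC') = weight w MR + weight w MC'" "weight w M = weight w MR + weight w MC"
    "weight w' (MR' \<union> MC) = weight w' MR' + weight w MC" "weight w' M' = weight w' MR' + weight w MC'"
    using split fins eqw by (simp_all add: weight_Un)
  \<comment> \<open>The hybrid \<open>MR' \<union> MC\<close> cannot beat \<open>M'\<close>, so
    \<open>MC'\<close> weighs at least as much as \<open>MC\<close>; then
    \<open>MR \<union> MC'\<close> ties with \<open>M\<close> and the tie-break compares
    cardinalities.\<close>
  have "card M \<le> card (MR \<union> MC')" using 1 2 w1 by linarith
  moreover have "card M = card MR + card MC" "card (MR \<union> MC') = card MR + card MC'"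
    "card M' = card MR' + card MC'"
    using split fins by (simp_all add: card_Un_disjoint)
  moreover have "card MR \<le> card MR' + 1"
  proof -
    \<comment> \<open>A path has at most one start: two points of \<open>R\<close> without
      predecessor both lead to \<open>u\<close>, and backward uniqueness makes one of them reach the
      other.\<close>
    have one: "p = q" if p: "p \<in> R - Range T" and q: "q \<in> R - Range T" for p q
    proof -
      have *: "(z, u) \<in> T\<^sup>*" if "z \<in> R - Range T" for z
        using that by (auto simp: R_def elim: rtranclE)
      have "(u, p) \<in> (T\<inverse>)\<^sup>*" "(u, q) \<in> (T\<inverse>)\<^sup>*" using *[OF p] *[OF q]
        by (auto simp: rtrancl_converse)
      then have "(p, q) \<in> (T\<inverse>)\<^sup>* \<or> (q, p) \<in> (T\<inverse>)\<^sup>*"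
        using single_valued_confluent[OF svT'] by blast
      then show ?thesis using p q by (auto simp: rtrancl_converse elim: rtranclE)
    qed
    \<comment> \<open>A predecessor of \<open>p\<close> under \<open>T\<close> provides an
      \<open>M'\<close>-edge at \<open>p\<close>, so points matched by \<open>M\<close> alone have
      none.\<close>
    have sub: "Domain MR - Domain MR' \<subseteq> R - Range T"
      by (auto simp: T_def defs Domain_iff)
    have "card (Domain MR - Domain MR') \<le> 1"
      using one sub by (intro card_le_Suc0_iff_eq[THEN iffD2, simplified One_nat_def[symmetric]])
        (use fins in \<open>auto simp: finite_Domain\<close>)
    moreover have "card (Domain MR) \<le> card (Domain MR - Domain MR') + card (Domain MR')"
      using fins diff_card_le_card_Diff[of "Domain MR'" "Domain MR"] by (simp add: finite_Domain)
    moreover have "single_valued MR" "single_valued MR'"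
      using mM mM' by (auto simp: defs matching_def single_valued_def)
    ultimately show ?thesis by (simp add: card_Domain_single_valued)
  qed
  ultimately show ?thesis by linarith
qed

lemma opt_card_row_change:
  assumes fin: "finite Q" and X: "finite X" and "\<And>x y. x \<notin> X \<Longrightarrow> w x y = w' x y"
  shows "opt_card Q w \<le> opt_card Q w' + card X"
  using X assms(3)
proof (induction X arbitrary: w' rule: finite_induct)
  case empty
  then have "w = w'" by blast
  then show ?case by simp
next
  case (insert u X)
  define v where "v = (\<lambda>x. if x = u then w x else w' x)"
  have "opt_card Q w \<le> opt_card Q v + card X"
    using insert.prems by (intro insert.IH) (auto simp: v_def)
  moreover obtain M where M: "optimal Q v M" using optimal_exists[OF fin] by blast
  moreover obtain M' where M': "optimal Q w' M'" using optimal_exists[OF fin] by blast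
  have "card M \<le> card M' + 1"
    by (rule optimal_card_row_change[OF fin M M', of u]) (simp add: v_def)
  then have "opt_card Q v \<le> opt_card Q w' + 1"
    by (simp add: opt_card_eqI[OF M] opt_card_eqI[OF M'])
  ultimately show ?case using insert.hyps by simp
qed

lemma matching_converse: "matching (Q\<inverse>) (M\<inverse>) \<longleftrightarrow> matching Q M"
  by (auto simp: matching_def)

lemma weight_converse: "weight (\<lambda>x y. w y x) (M\<inverse>) = weight w M"
  unfolding weight_def by (rule sum.reindex_bij_witness[where i = prod.swap and j = prod.swap]) auto

lemma opt_card_converse:
  assumes "finite Q"
  shows "opt_card (Q\<inverse>) (\<lambda>x y. w y x) = opt_card Q w"
proof -
  obtain M where M: "optimal Q w M" using optimal_exists[OF assms] by blast
  have "optimal (Q\<inverse>) (\<lambda>x y. w y x) (M\<inverse>)"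
    unfolding optimal_def
  proof (intro conjI allI impI)
    show "matching (Q\<inverse>) (M\<inverse>)" using M by (simp add: matching_converse optimal_def)
    fix N assume "matching (Q\<inverse>) N"
    then have "matching Q (N\<inverse>)" using matching_converse[of Q "N\<inverse>"] by simp
    then show "weight (\<lambda>x y. w y x) N < weight (\<lambda>x y. w y x) (M\<inverse>) \<or>
      weight (\<lambda>x y. w y x) N = weight (\<lambda>x y. w y x) (M\<inverse>) \<and> card (M\<inverse>) \<le> card N"
      using M weight_converse[of w "N\<inverse>"] by (auto simp: optimal_def weight_converse)
  qed
  then show ?thesis using opt_card_eqI[OF M] by (simp add: opt_card_eqI)
qed

lemma opt_card_column_change:
  assumes "finite Q" "finite X" "\<And>x y. y \<notin> X \<Longrightarrow> w x y = w' x y"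
  shows "opt_card Q w \<le> opt_card Q w' + card X"
  using opt_card_row_change[of "Q\<inverse>" X "\<lambda>x y. w y x" "\<lambda>x y. w' y x"] assms
  by (simp add: opt_card_converse)

text \<open>The value at a point enters the weight through one row and one column, hence the factor
  two.\<close>

lemma opt_card_potential_change:
  fixes f g :: "'a \<Rightarrow> real"
  assumes "finite Q" "finite X" "\<And>x. x \<notin> X \<Longrightarrow> f x = g x"
  shows "opt_card Q (\<lambda>x y. f x - f y - m x y) \<le> opt_card Q (\<lambda>x y. g x - g y - m x y) + 2 * card X"
proof -
  have "opt_card Q (\<lambda>x y. f x - f y - m x y) \<le> opt_card Q (\<lambda>x y. g x - f y - m x y) + card X"
    using assms by (intro opt_card_row_change) auto
  also have "opt_card Q (\<lambda>x y. g x - f y - m x y) \<le> opt_card Q (\<lambda>x y. g x - g y - m x y) + card X"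
    using assms by (intro opt_card_column_change) auto
  finally show ?thesis by simp
qed

section \<open>Elementary exchanges in matchings\<close>

lemma matching_exchange:
  assumes fin: "finite Q" and M: "matching Q M"
    and e: "(x, y) \<in> M" "(x', y') \<in> M" "x \<noteq> x'" and Q: "(x, y') \<in> Q" "(x', y) \<in> Q"
    and M': "M' = (M - {(x, y), (x', y')}) \<union> {(x, y'), (x', y)}"
  shows "matching Q M'" "weight w M' = weight w M - w x y - w x' y' + w x y' + w x' y"
    "card M' = card M"
proof -
  note D = matchingD[OF M]
  have finM: "finite M" using fin D(1) finite_subset by blast
  have ne: "y \<noteq> y'" using e D(3) by blast
  show "matching Q M'"
    using D e Q ne unfolding M' by (intro matchingI) blast+
  have dis: "(M - {(x, y), (x', y')}) \<inter> {(x, y'), (x', y)} = {}"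
    using D e ne by blast
  have sp: "M = (M - {(x, y), (x', y')}) \<union> {(x, y), (x', y')}" using e by blast
  \<comment> \<open>Proved for every weight, so that the constant weight one yields the cardinality
    afterwards.\<close>
  have wt: "weight w M' = weight w M - w x y - w x' y' + w x y' + w x' y" for w
  proof -
    have "weight w M = weight w (M - {(x, y), (x', y')}) + weight w {(x, y), (x', y')}"
      using finM weight_Un[of "M - {(x, y), (x', y')}" "{(x, y), (x', y')}" w] sp by auto
    moreover have "weight w M' = weight w (M - {(x, y), (x', y')}) + weight w {(x, y'), (x', y)}"
      unfolding M' using finM dis by (intro weight_Un) auto
    ultimately show ?thesis using \<open>x \<noteq> x'\<close> by (simp add: weight_def)
  qed
  show "weight w M' = weight w M - w x y - w x' y' + w x y' + w x' y" by (rule wt)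
  show "card M' = card M" using wt[of "\<lambda>_ _. 1"] by (simp add: weight_def)
qed

lemma matching_shift_upper:
  assumes fin: "finite Q" and M: "matching Q M" and e: "(x, y) \<in> M"
    and Q: "(x', y) \<in> Q" "x' \<notin> Domain M"
    and M': "M' = insert (x', y) (M - {(x, y)})"
  shows "matching Q M'" "card M' = card M" "weight w M' = weight w M - w x y + w x' y"
proof -
  note D = matchingD[OF M]
  have finM: "finite M" using fin D(1) finite_subset by blast
  show "matching Q M'"
    using D e Q unfolding M' by (intro matchingI) blast+
  have new: "(x', y) \<notin> M - {(x, y)}" using Q by blast
  show "card M' = card M" unfolding M' using new finM e by (simp add: card_Suc_Diff1 del: card_Diff_insert)
  show "weight w M' = weight w M - w x y + w x' y"
    unfolding M' weight_def using new finM e by (simp add: sum_diff1)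
qed

lemma matching_shift_lower:
  assumes fin: "finite Q" and M: "matching Q M" and e: "(x, y) \<in> M"
    and Q: "(x, y') \<in> Q" "y' \<notin> Range M"
    and M': "M' = insert (x, y') (M - {(x, y)})"
  shows "matching Q M'" "card M' = card M" "weight w M' = weight w M - w x y + w x y'"
proof -
  note D = matchingD[OF M]
  have finM: "finite M" using fin D(1) finite_subset by blast
  show "matching Q M'"
    using D e Q unfolding M' by (intro matchingI) blast+
  have new: "(x, y') \<notin> M - {(x, y)}" using Q by blast
  show "card M' = card M" unfolding M' using new finM e by (simp add: card_Suc_Diff1 del: card_Diff_insert)
  show "weight w M' = weight w M - w x y + w x y'"
    unfolding M' weight_def using new finM e by (simp add: sum_diff1)
qed

section \<open>Uncrossing\<close>

text \<open>Counting crossings as a weight allows the weight formulas of the exchanges to compute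
  their change as well.\<close>

abbreviation crossings :: "('a \<Rightarrow> 'l) \<Rightarrow> ('a \<times> 'a) set \<Rightarrow> real" where
  "crossings lev \<equiv> weight (\<lambda>x y. of_bool (lev x \<noteq> lev y))"

text \<open>One direction of the grid in abstract form: \<open>lev\<close> is the coordinate in that
  direction, \<open>h\<close> exchanges the levels \<open>a\<close> and \<open>b\<close> along
  lines, and the distance splits into \<open>\<rho>\<close> along the direction and
  \<open>\<sigma>\<close> across it. Assumption \<open>f\<close> says that the pair of a point at
  level \<open>a\<close> and its mirror image at level \<open>b\<close>, in this order, is not
  violated.\<close>

locale uncrossing =
  fixes V :: "'a set" and Q :: "('a \<times> 'a) set" and h :: "'a \<Rightarrow> 'a" and lev :: "'a \<Rightarrow> 'l" and a b :: 'l
    and \<rho> :: "'l \<Rightarrow> 'l \<Rightarrow> real" and \<sigma> :: "'a \<Rightarrow> 'a \<Rightarrow> real" and f :: "'a \<Rightarrow> real"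
  assumes fin: "finite Q" and QV: "Q \<subseteq> V \<times> V" and ab: "a \<noteq> b"
    and hh: "h (h x) = x"
    and lev_a: "lev x = a \<Longrightarrow> lev (h x) = b" and lev_b: "lev x = b \<Longrightarrow> lev (h x) = a"
    and Q_left: "(x, y) \<in> Q \<Longrightarrow> (h x, y) \<in> Q" and Q_right: "(x, y) \<in> Q \<Longrightarrow> (x, h y) \<in> Q"
    and triangle: "\<rho> i k \<le> \<rho> i j + \<rho> j k" and refl: "\<rho> i i = 0"
    and \<sigma>_left: "\<sigma> (h x) y = \<sigma> x y" and \<sigma>_right: "\<sigma> x (h y) = \<sigma> x y"
    and f: "x \<in> V \<Longrightarrow> lev x = a \<Longrightarrow> f x \<le> f (h x) + \<rho> a b"
begin

abbreviation "w \<equiv> \<lambda>x y. f x - f y - (\<rho> (lev x) (lev y) + \<sigma> x y)"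

text \<open>Two exchanges, using the edges \<open>(h p, v)\<close> and \<open>(q, h v)\<close>, turn
  a crossing edge with left endpoint \<open>p\<close> into one with left endpoint \<open>q\<close>;
  \<open>step M\<close> records this move.\<close>

definition step :: "('a \<times> 'a) set \<Rightarrow> ('a \<times> 'a) set" where
  "step M = {(p, q). lev p = a \<and> lev q = a \<and> (\<exists>v. lev v = b \<and> (h p, v) \<in> M \<and> (q, h v) \<in> M)}"

text \<open>
  Two exchanges either decrease the number of crossings or move the crossing edge from \<open>x\<close> to its
  unique successor under \<open>step M\<close>; since \<open>x\<close> has no predecessor, the set of points that can still be
  visited shrinks.
\<close>

lemma uncross:
  assumes "matching Q M" "(x, y) \<in> M" "lev x = a" "lev y = b"
  shows "\<exists>M'. matching Q M' \<and> card M' = card M \<and> weight w M \<le> weight w M' \<and>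
    crossings lev M' < crossings lev M"
  using assms
proof (induction "card ((step M)\<^sup>* `` {x})" arbitrary: M x y rule: less_induct)
  case less
  note M = less.prems(1) and e = less.prems(2) and lx = less.prems(3) and ly = less.prems(4)
  note D = matchingD[OF M]
  have finM: "finite M" using fin D(1) finite_subset by blast
  have xy: "x \<in> V" "y \<in> V" "(h x, y) \<in> Q" "(x, h y) \<in> Q"
    using D(1) e QV Q_left Q_right by blast+
  have lhx: "lev (h x) = b" using lx lev_a by blast
  have fx: "f x \<le> f (h x) + \<rho> a b" using f xy lx by blast
  show ?case
  proof (cases "h x \<in> Domain M")
    case False
    \<comment> \<open>If \<open>h x\<close> is free on the left, sliding the edge to
      \<open>(h x, y)\<close> puts it inside level \<open>b\<close>; the gain of
      \<open>\<rho> a b\<close> covers the loss \<open>f x - f (h x)\<close>.\<close>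
    define M' where "M' = insert (h x, y) (M - {(x, y)})"
    note S = matching_shift_upper[OF fin M e xy(3) False M'_def]
    have "weight w M \<le> weight w M'" unfolding S(3)
      using fx by (simp add: lx ly lhx \<sigma>_left refl)
    moreover have "crossings lev M' < crossings lev M" unfolding S(3)
      using ab by (simp add: lx ly lhx)
    ultimately show ?thesis using S by blast
  next
    case True
    then obtain v where v: "(h x, v) \<in> M" by blast
    have neq: "x \<noteq> h x" using lx lhx ab by metis
    have xvQ: "(x, v) \<in> Q" using v D(1) Q_left[of "h x" v] by (auto simp: hh)
    \<comment> \<open>Otherwise right endpoints are exchanged with the edge at \<open>h x\<close>.
      By the triangle inequality the weight does not drop, and the crossings decrease unless
      \<open>v\<close> is at level \<open>b\<close>, where both stay the same.\<close>
    define M1 where "M1 = (M - {(x, y), (h x, v)}) \<union> {(x, v), (h x, y)}"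
    note S1 = matching_exchange[OF fin M e v neq xvQ xy(3) M1_def]
    have wt1: "weight w M1 = weight w M + \<rho> a b + \<rho> b (lev v) - \<rho> a (lev v)"
      unfolding S1(2) by (simp add: lx ly lhx \<sigma>_left refl)
    show ?thesis
    proof (cases "lev v = b")
      case False
      have "crossings lev M1 < crossings lev M" unfolding S1(2)
        using ab False by (simp add: lx ly lhx)
      moreover have "weight w M \<le> weight w M1" using wt1 triangle[of a "lev v" b] by linarith
      ultimately show ?thesis using S1 by blast
    next
      case lv: True
      have wt1': "weight w M1 = weight w M" using wt1 lv by (simp add: refl)
      have cr1: "crossings lev M1 = crossings lev M" unfolding S1(2)
        using ab lv by (simp add: lx ly lhx)
      have vV: "v \<in> V" using v D(1) QV by blast
      have lhv: "lev (h v) = a" using lv lev_b by blast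
      have e1: "(x, v) \<in> M1" by (simp add: M1_def)
      have xhvQ: "(x, h v) \<in> Q" using xvQ Q_right by blast
      have fv: "f (h v) \<le> f v + \<rho> a b" using f[of "h v"] xhvQ QV lhv by (auto simp: hh)
      show ?thesis
      proof (cases "h v \<in> Range M1")
        case False
        define M' where "M' = insert (x, h v) (M1 - {(x, v)})"
        note S = matching_shift_lower[OF fin S1(1) e1 xhvQ False M'_def]
        have "weight w M \<le> weight w M'" unfolding S(3) wt1'
          using fv by (simp add: lx lv lhv \<sigma>_right refl)
        moreover have "crossings lev M' < crossings lev M" unfolding S(3) cr1
          using ab by (simp add: lx lv lhv)
        ultimately show ?thesis using S(1,2) S1(3) by auto
      next
        case True
        then obtain t where t: "(t, h v) \<in> M1" by blast
        have tx: "x \<noteq> t" using matchingD(2)[OF S1(1) e1, of "h v"] t lv lhv ab by metis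
        have tvQ: "(t, v) \<in> Q" using t matchingD(1)[OF S1(1)] Q_right[of t "h v"] by (auto simp: hh)
        \<comment> \<open>The mirror-image exchange, with the edge ending in \<open>h v\<close>. It
          makes no progress only if \<open>t\<close> is at level \<open>a\<close>; then the crossing
          edge has moved to \<open>(t, v)\<close>.\<close>
        define M2 where "M2 = (M1 - {(x, v), (t, h v)}) \<union> {(x, h v), (t, v)}"
        note S2 = matching_exchange[OF fin S1(1) e1 t tx xhvQ tvQ M2_def]
        have wt2: "weight w M2 = weight w M + \<rho> a b + \<rho> (lev t) a - \<rho> (lev t) b"
          unfolding S2(2) wt1' by (simp add: lx lv lhv \<sigma>_right refl)
        show ?thesis
        proof (cases "lev t = a")
          case False
          have "crossings lev M2 < crossings lev M" unfolding S2(2) cr1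
            using ab False by (simp add: lx lv lhv)
          moreover have "weight w M \<le> weight w M2" using wt2 triangle[of "lev t" b a] by linarith
          ultimately show ?thesis using S1(3) S2(1,3) by auto
        next
          case lt: True
          have wt2': "weight w M2 = weight w M" using wt2 lt by (simp add: refl)
          have cr2: "crossings lev M2 = crossings lev M" unfolding S2(2) cr1
            using ab lt by (simp add: lx lv lhv)
          have tM: "(t, h v) \<in> M" using t lhv lv ly ab by (auto simp: M1_def)
          have xt: "(x, t) \<in> step M" using lx lt lv v tM by (auto simp: step_def)
          \<comment> \<open>The only edge of \<open>M\<close> leaving \<open>x\<close> ends at level
            \<open>b\<close>, whereas a predecessor would require one ending at level
            \<open>a\<close>.\<close>
          have x_min: "(p, x) \<notin> step M" for p
          proof
            assume "(p, x) \<in> step M"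
            then obtain s where "lev s = b" "(x, h s) \<in> M" by (auto simp: step_def)
            then show False using D(2)[OF e, of "h s"] lev_b[of s] ly ab by simp
          qed
          \<comment> \<open>The exchanges create no new step from a point other than
            \<open>x\<close>; together with \<open>x_min\<close>, walks from \<open>t\<close> under
            \<open>M2\<close> remain old walks that never visit \<open>x\<close>.\<close>
          have sub: "(p, q) \<in> step M" if pq: "(p, q) \<in> step M2" and px: "p \<noteq> x" for p q
          proof -
            obtain s where lp: "lev p = a" and lq: "lev q = a" and ls: "lev s = b"
              and s: "(h p, s) \<in> M2" "(q, h s) \<in> M2"
              using pq by (auto simp: step_def)
            have "h p \<noteq> h x" using px hh by metis
            moreover have "lev (h p) = b" "lev (h s) = a" using lp ls lev_a lev_b by auto
            ultimately have hp: "(h p, s) \<in> M" using s(1) lx lt ab by (auto simp: M1_def M2_def)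
            have "h s \<noteq> h v"
            proof
              assume "h s = h v"
              then have "s = v" using hh by metis
              then show False using D(3)[OF hp, of "h x"] v \<open>h p \<noteq> h x\<close> by blast
            qed
            then have "(q, h s) \<in> M"
              using s(2) \<open>lev (h s) = a\<close> lv ly ab by (auto simp: M1_def M2_def)
            then show ?thesis using hp lp lq ls by (auto simp: step_def)
          qed
          have reach: "(t, q) \<in> (step M)\<^sup>* \<and> q \<noteq> x" if "(t, q) \<in> (step M2)\<^sup>*" for q
            using that
          proof induction
            case base
            then show ?case using tx by blast
          next
            case (step p q)
            then have "(p, q) \<in> step M" using sub by blast
            then show ?case using step.IH x_min by (auto intro: rtrancl_into_rtrancl)
          qed
          have "(step M)\<^sup>* `` {x} \<subseteq> insert x (Domain M)"
          proof
            fix q assume "q \<in> (step M)\<^sup>* `` {x}"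
            then have "(x, q) \<in> (step M)\<^sup>*" by simp
            then show "q \<in> insert x (Domain M)" by cases (auto simp: step_def)
          qed
          then have finR: "finite ((step M)\<^sup>* `` {x})"
            by (rule finite_subset) (simp add: finM finite_Domain)
          have "(step M2)\<^sup>* `` {t} \<subset> (step M)\<^sup>* `` {x}"
            using reach xt by (auto intro: converse_rtrancl_into_rtrancl)
          then have "card ((step M2)\<^sup>* `` {t}) < card ((step M)\<^sup>* `` {x})"
            by (rule psubset_card_mono[OF finR])
          moreover have "(t, v) \<in> M2" by (simp add: M2_def)
          ultimately obtain M' where "matching Q M'" "card M' = card M2" "weight w M2 \<le> weight w M'"
            "crossings lev M' < crossings lev M2"
            using less.hyps[of M2 t v] S2(1) lt lv by blast
          then show ?thesis using S1(3) S2(3) wt2' cr2 by auto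
        qed
      qed
    qed
  qed
qed

end

lemma crossings_eq:
  assumes "finite M"
  shows "crossings lev M = card {e\<in>M. lev (fst e) \<noteq> lev (snd e)}"
  using assms by (simp add: weight_def sum.If_cases of_bool_def Int_def)

text \<open>Among the optimal matchings, one with the fewest crossings has none, because uncrossing
  preserves optimality. It is then also optimal in the smaller edge set, where fewer competitors
  exist.\<close>

lemma optimal_noncrossing:
  assumes fin: "finite Q"
    and uncross: "\<And>M x y. matching Q M \<Longrightarrow> (x, y) \<in> M \<Longrightarrow> lev x \<noteq> lev y \<Longrightarrow>
      \<exists>M'. matching Q M' \<and> card M' = card M \<and> weight w M \<le> weight w M' \<and> crossings lev M' < crossings lev M"
  shows "opt_card Q w = opt_card {(x, y) \<in> Q. lev x = lev y} w"
proof -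
  obtain M0 where M0: "optimal Q w M0" using optimal_exists[OF fin] by blast
  define k where "k = (\<lambda>M. card {e\<in>M. lev (fst e) \<noteq> lev (snd e)})"
  define M where "M = arg_min k (optimal Q w)"
  have M: "optimal Q w M" and min: "\<And>N. optimal Q w N \<Longrightarrow> k M \<le> k N"
    using arg_min_natI[of "optimal Q w" M0 k] arg_min_nat_le[of "optimal Q w" _ k] M0
    by (auto simp: M_def)
  have "lev x = lev y" if e: "(x, y) \<in> M" for x y
  proof (rule ccontr)
    assume "lev x \<noteq> lev y"
    moreover have "matching Q M" using M by (simp add: optimal_def)
    ultimately obtain M' where M': "matching Q M'" "card M' = card M" "weight w M \<le> weight w M'"
      "crossings lev M' < crossings lev M"
      using uncross[OF _ e] by blast
    have "weight w M' = weight w M" using M M'(1,3) unfolding optimal_def by force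
    then have "optimal Q w M'" using M M'(1,2) by (simp add: optimal_def)
    moreover have "finite M" "finite M'"
      using M M'(1) fin finite_subset by (auto simp: optimal_def matching_def)
    ultimately show False using min[of M'] M'(4) by (simp add: crossings_eq k_def)
  qed
  then have "matching {(x, y) \<in> Q. lev x = lev y} M"
    using M by (auto simp: optimal_def matching_def)
  moreover have "matching Q N" if "matching {(x, y) \<in> Q. lev x = lev y} N" for N
    using that by (auto simp: matching_def)
  ultimately have "optimal {(x, y) \<in> Q. lev x = lev y} w M"
    using M by (simp add: optimal_def)
  then show ?thesis using M by (simp add: opt_card_eqI)
qed

section \<open>Dimension reduction\<close>

text \<open>McShane extension for an asymmetric distance: the pointwise minimum of the upper bounds
  imposed by the known values.\<close>

lemma quasimetric_extension:
  fixes \<rho> :: "'a \<Rightarrow> 'a \<Rightarrow> real"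
  assumes fin: "finite S" and triangle: "\<And>x y z. \<rho> x z \<le> \<rho> x y + \<rho> y z" and refl: "\<And>x. \<rho> x x = 0"
    and f: "\<And>x y. x \<in> S \<Longrightarrow> y \<in> S \<Longrightarrow> f x - f y \<le> \<rho> x y"
  shows "\<exists>g. (\<forall>x\<in>S. g x = f x) \<and> (\<forall>x y. g x - g y \<le> \<rho> x y)"
proof (cases "S = {}")
  case True
  have "\<rho> x c - \<rho> y c \<le> \<rho> x y" for x y c using triangle[of x c y] by linarith
  then show ?thesis using True by (intro exI[of _ "\<lambda>x. \<rho> x undefined"]) simp
next
  case False
  define g where "g = (\<lambda>x. Min ((\<lambda>s. f s + \<rho> x s) ` S))"
  have le: "g x \<le> f s + \<rho> x s" if "s \<in> S" for x s
    unfolding g_def using fin that by (intro Min_le) auto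
  have ex: "\<exists>s\<in>S. g x = f s + \<rho> x s" for x
  proof -
    have "g x \<in> (\<lambda>s. f s + \<rho> x s) ` S"
      unfolding g_def using fin False by (intro Min_in) auto
    then show ?thesis by blast
  qed
  have "g x = f x" if "x \<in> S" for x
  proof -
    obtain s where s: "s \<in> S" "g x = f s + \<rho> x s" using ex by blast
    then show ?thesis using le[OF that, of x] f[OF that s(1)] refl[of x] by linarith
  qed
  moreover have "g x - g y \<le> \<rho> x y" for x y
  proof -
    obtain s where s: "s \<in> S" "g y = f s + \<rho> y s" using ex by blast
    then show ?thesis using le[OF s(1), of x] triangle[of x s y] by linarith
  qed
  ultimately show ?thesis by blast
qed

text \<open>For prefix sums \<open>U\<close> of the upper and \<open>L\<close> of the lower bounds
  this is the one-dimensional bounding distance on the positions of a line. As a maximum of two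
  potential differences it satisfies the triangle inequality at all indices, also outside the
  grid.\<close>

definition line_dist :: "(nat \<Rightarrow> nat \<Rightarrow> real) \<Rightarrow> (nat \<Rightarrow> nat \<Rightarrow> real) \<Rightarrow> nat \<Rightarrow> nat \<Rightarrow> nat \<Rightarrow> real" where
  "line_dist U L r i j = max (U r i - U r j) (L r i - L r j)"

definition grid_dist ::
    "nat \<Rightarrow> (nat \<Rightarrow> nat \<Rightarrow> real) \<Rightarrow> (nat \<Rightarrow> nat \<Rightarrow> real) \<Rightarrow> (nat \<Rightarrow> nat) \<Rightarrow> (nat \<Rightarrow> nat) \<Rightarrow> real" where
  "grid_dist d U L x y = (\<Sum>r\<in>{1..d}. line_dist U L r (x r) (y r))"

lemma line_dist_refl: "line_dist U L r i i = 0"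
  by (simp add: line_dist_def)

lemma line_dist_triangle: "line_dist U L r i k \<le> line_dist U L r i j + line_dist U L r j k"
  by (auto simp: line_dist_def max_def)

lemma grid_dist_refl: "grid_dist d U L x x = 0"
  by (simp add: grid_dist_def line_dist_refl)

lemma grid_dist_triangle: "grid_dist d U L x z \<le> grid_dist d U L x y + grid_dist d U L y z"
  unfolding grid_dist_def sum.distrib[symmetric] by (intro sum_mono line_dist_triangle)

lemma grid_dist_line:
  assumes "r \<in> {1..d}"
  shows "grid_dist d U L x (x(r := i)) = line_dist U L r (x r) i"
proof -
  have "(\<Sum>s\<in>{1..d}. line_dist U L s (x s) ((x(r := i)) s))
      = (\<Sum>s\<in>{1..d}. if s = r then line_dist U L r (x r) i else 0)"
    by (intro sum.cong) (auto simp: line_dist_refl)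
  then show ?thesis
    using assms by (simp add: grid_dist_def)
qed

lemma finite_hypergrid: "finite (hypergrid n d)"
  by (simp add: hypergrid_def finite_PiE)

lemma hypergrid_upd:
  assumes "x \<in> hypergrid n d" "r \<in> {1..d}" "i \<in> {1..n}"
  shows "x(r := i) \<in> hypergrid n d"
  using assms by (auto simp: hypergrid_def PiE_iff extensional_def)

lemma hypergrid_coord:
  assumes "x \<in> hypergrid n d" "r \<in> {1..d}"
  shows "x r \<in> {1..n}"
  using assms by (auto simp: hypergrid_def)

text \<open>Each line is repaired separately, by extending its values outside \<open>X\<close> to
  the whole line; the other directions are not controlled.\<close>

lemma line_refill:
  fixes f :: "(nat \<Rightarrow> nat) \<Rightarrow> real"
  assumes r: "r \<in> {1..d}"
    and line: "\<And>x i. x \<in> hypergrid n d - X \<Longrightarrow> x(r := i) \<in> hypergrid n d - X \<Longrightarrow>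
      f x - f (x(r := i)) \<le> line_dist U L r (x r) i"
  shows "\<exists>g. (\<forall>x. x \<notin> X \<longrightarrow> g x = f x) \<and>
    (\<forall>x\<in>hypergrid n d. \<forall>i\<in>{1..n}. g x - g (x(r := i)) \<le> line_dist U L r (x r) i)"
proof -
  let ?V = "hypergrid n d"
  define S where "S = (\<lambda>z::nat\<Rightarrow>nat. {i\<in>{1..n}. z(r := i) \<in> ?V - X})"
  have "\<exists>G. (\<forall>i\<in>S z. G i = f (z(r := i))) \<and> (\<forall>i j. G i - G j \<le> line_dist U L r i j)" for z
  proof (rule quasimetric_extension)
    show "finite (S z)" by (simp add: S_def)
    fix i j assume "i \<in> S z" "j \<in> S z"
    then show "f (z(r := i)) - f (z(r := j)) \<le> line_dist U L r i j"
      using line[of "z(r := i)" j] by (auto simp: S_def)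
  qed (rule line_dist_triangle line_dist_refl)+
  then obtain G where G: "\<And>z i. i \<in> S z \<Longrightarrow> G z i = f (z(r := i))"
    "\<And>z i j. G z i - G z j \<le> line_dist U L r i j"
    by metis
  \<comment> \<open>Normalising coordinate \<open>r\<close> to 0 gives all points of a line the same
    representative, hence the same extension \<open>G\<close>.\<close>
  define g where "g = (\<lambda>x. if x \<in> ?V then G (x(r := 0)) (x r) else f x)"
  have "g x = f x" if "x \<notin> X" for x
    using G(1)[of "x r" "x(r := 0)"] that hypergrid_coord[OF _ r] by (auto simp: g_def S_def)
  moreover have "g x - g (x(r := i)) \<le> line_dist U L r (x r) i" if "x \<in> ?V" "i \<in> {1..n}" for x i
    using that hypergrid_upd[OF that(1) r that(2)] G(2) by (simp add: g_def)
  ultimately show ?thesis by blast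
qed

definition agree_pairs :: "nat \<Rightarrow> nat \<Rightarrow> nat \<Rightarrow> ((nat \<Rightarrow> nat) \<times> (nat \<Rightarrow> nat)) set" where
  "agree_pairs n d s = {(x, y) \<in> hypergrid n d \<times> hypergrid n d. \<forall>i\<in>{1..s}. x i = y i}"

lemma finite_agree_pairs: "finite (agree_pairs n d s)"
  by (rule finite_subset[of _ "hypergrid n d \<times> hypergrid n d"])
    (auto simp: agree_pairs_def finite_hypergrid)

text \<open>A crossing edge fixes two levels \<open>a\<close>, \<open>b\<close> of coordinate
  \<open>Suc s\<close>, and swapping these levels yields an instance of the abstract uncrossing. The
  swap leaves the first \<open>s\<close> coordinates alone, so it respects the allowed
  pairs.\<close>

lemma opt_card_no_line_violation:
  fixes f :: "(nat \<Rightarrow> nat) \<Rightarrow> real"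
  assumes s: "Suc s \<le> d"
    and line: "\<And>x i. x \<in> hypergrid n d \<Longrightarrow> i \<in> {1..n} \<Longrightarrow>
      f x - f (x(Suc s := i)) \<le> line_dist U L (Suc s) (x (Suc s)) i"
  shows "opt_card (agree_pairs n d s) (\<lambda>x y. f x - f y - grid_dist d U L x y) =
    opt_card (agree_pairs n d (Suc s)) (\<lambda>x y. f x - f y - grid_dist d U L x y)"
proof -
  let ?V = "hypergrid n d" and ?Q = "agree_pairs n d s" and ?r = "Suc s"
  let ?w = "\<lambda>x y. f x - f y - grid_dist d U L x y"
  define \<sigma> where "\<sigma> = (\<lambda>x y. \<Sum>q\<in>{1..d} - {?r}. line_dist U L q (x q) (y q))"
  have r: "?r \<in> {1..d}" using s by simp
  have "grid_dist d U L x y = line_dist U L ?r (x ?r) (y ?r) + \<sigma> x y" for x y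
    unfolding grid_dist_def \<sigma>_def by (rule sum.remove[OF _ r]) simp
  then have w: "?w = (\<lambda>x y. f x - f y - (line_dist U L ?r (x ?r) (y ?r) + \<sigma> x y))"
    by simp
  have "opt_card ?Q ?w = opt_card {(x, y) \<in> ?Q. x ?r = y ?r} ?w"
  proof (rule optimal_noncrossing[OF finite_agree_pairs])
    fix M x y assume M: "matching ?Q M" "(x, y) \<in> M" "x ?r \<noteq> y ?r"
    define a b where "a = x ?r" and "b = y ?r"
    have xy: "x \<in> ?V" "y \<in> ?V" using M matchingD(1)[OF M(1)] by (auto simp: agree_pairs_def)
    have ab: "a \<in> {1..n}" "b \<in> {1..n}" "a \<noteq> b"
      using hypergrid_coord[OF xy(1) r] hypergrid_coord[OF xy(2) r] M(3) by (simp_all add: a_def b_def)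
    define h where "h = (\<lambda>x::nat\<Rightarrow>nat. x(?r := if x ?r = a then b else if x ?r = b then a else x ?r))"
    have hV: "h x \<in> ?V" if "x \<in> ?V" for x
      unfolding h_def using hypergrid_upd[OF that r] hypergrid_coord[OF that r] ab by auto
    interpret uncrossing ?V ?Q h "\<lambda>x. x ?r" a b "line_dist U L ?r" \<sigma> f
    proof
      show "finite ?Q" by (rule finite_agree_pairs)
      show "?Q \<subseteq> ?V \<times> ?V" by (auto simp: agree_pairs_def)
      show "a \<noteq> b" by (rule ab)
      show "h (h x) = x" for x by (auto simp: h_def)
      show "x ?r = a \<Longrightarrow> h x ?r = b" for x by (simp add: h_def)
      show "x ?r = b \<Longrightarrow> h x ?r = a" for x by (simp add: h_def)
      show "(x, y) \<in> ?Q \<Longrightarrow> (h x, y) \<in> ?Q" for x y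
        using hV by (auto simp: agree_pairs_def) (auto simp: h_def)
      show "(x, y) \<in> ?Q \<Longrightarrow> (x, h y) \<in> ?Q" for x y
        using hV by (auto simp: agree_pairs_def) (auto simp: h_def)
      show "line_dist U L ?r i k \<le> line_dist U L ?r i j + line_dist U L ?r j k" for i j k
        by (rule line_dist_triangle)
      show "line_dist U L ?r i i = 0" for i by (rule line_dist_refl)
      show "\<sigma> (h x) y = \<sigma> x y" for x y by (auto simp: \<sigma>_def h_def intro: sum.cong)
      show "\<sigma> x (h y) = \<sigma> x y" for x y by (auto simp: \<sigma>_def h_def intro: sum.cong)
      show "f x \<le> f (h x) + line_dist U L ?r a b" if "x \<in> ?V" "x ?r = a" for x
        using line[OF that(1) ab(2)] that(2) by (simp add: h_def)
    qed
    show "\<exists>M'. matching ?Q M' \<and> card M' = card M \<and> weight ?w M \<le> weight ?w M' \<and>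
        crossings (\<lambda>x. x ?r) M' < crossings (\<lambda>x. x ?r) M"
      unfolding w by (rule uncross[OF M(1,2)]) (simp_all add: a_def b_def)
  qed
  also have "{(x, y) \<in> ?Q. x ?r = y ?r} = agree_pairs n d ?r"
    by (auto simp: agree_pairs_def atLeastAtMostSuc_conv)
  finally show ?thesis .
qed

text \<open>Induction from the last direction backwards. Replacing \<open>f\<close> by its repair in
  direction \<open>r\<close> and returning to \<open>f\<close> costs \<open>2 * card (X r)\<close>
  each way; the return is made because nothing is known about the repaired function in the other
  directions.\<close>

lemma opt_card_agree_pairs_le:
  fixes f :: "(nat \<Rightarrow> nat) \<Rightarrow> real"
  assumes s: "s \<le> d" and X: "\<And>r. r \<in> {1..d} \<Longrightarrow> X r \<subseteq> hypergrid n d"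
    and line: "\<And>r x i. r \<in> {1..d} \<Longrightarrow> x \<in> hypergrid n d - X r \<Longrightarrow> x(r := i) \<in> hypergrid n d - X r \<Longrightarrow>
      f x - f (x(r := i)) \<le> line_dist U L r (x r) i"
  shows "opt_card (agree_pairs n d (d - s)) (\<lambda>x y. f x - f y - grid_dist d U L x y) \<le>
    4 * (\<Sum>r\<in>{d - s<..d}. card (X r))"
  using s
proof (induction s)
  case 0
  let ?w = "\<lambda>x y. f x - f y - grid_dist d U L x y"
  obtain M where M: "optimal (agree_pairs n d d) ?w M"
    using optimal_exists[OF finite_agree_pairs] by blast
  have "fst e = snd e" if "e \<in> M" for e
  proof -
    have "e \<in> agree_pairs n d d" using that M by (auto simp: optimal_def matching_def)
    then have "fst e \<in> {1..d} \<rightarrow>\<^sub>E {1..n}" "snd e \<in> {1..d} \<rightarrow>\<^sub>E {1..n}" "\<forall>i\<in>{1..d}. fst e i = snd e i"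
      by (auto simp: agree_pairs_def hypergrid_def)
    then show ?thesis by (intro PiE_ext) auto
  qed
  \<comment> \<open>Only loops remain, all of weight zero, so the empty matching ties with
    \<open>M\<close> and the tie-break forces \<open>M\<close> to be empty.\<close>
  then have "weight ?w M = 0"
    unfolding weight_def by (intro sum.neutral ballI) (simp add: grid_dist_refl)
  moreover have "matching (agree_pairs n d d) {}" by (simp add: matching_def)
  ultimately have "card M = 0"
    using M by (force simp: optimal_def weight_def)
  then show ?case using opt_card_eqI[OF M] by simp
next
  case (Suc s)
  let ?r = "d - s"
  have r: "?r \<in> {1..d}" "d - s = Suc (d - Suc s)" using Suc.prems by auto
  have "\<exists>g. (\<forall>x. x \<notin> X ?r \<longrightarrow> g x = f x) \<and>
      (\<forall>x\<in>hypergrid n d. \<forall>i\<in>{1..n}. g x - g (x(?r := i)) \<le> line_dist U L ?r (x ?r) i)"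
    by (rule line_refill[OF r(1) line[OF r(1)]])
  then obtain g where g: "\<And>x. x \<notin> X ?r \<Longrightarrow> g x = f x"
    "\<And>x i. x \<in> hypergrid n d \<Longrightarrow> i \<in> {1..n} \<Longrightarrow> g x - g (x(?r := i)) \<le> line_dist U L ?r (x ?r) i"
    by metis
  have finX: "finite (X ?r)" using X[OF r(1)] finite_hypergrid finite_subset by blast
  let ?c = "\<lambda>f q. opt_card (agree_pairs n d q) (\<lambda>x y. f x - f y - grid_dist d U L x y)"
  have "?c f (d - Suc s) \<le> ?c g (d - Suc s) + 2 * card (X ?r)"
    using g(1) by (intro opt_card_potential_change finite_agree_pairs finX) simp
  also have "?c g (d - Suc s) = ?c g ?r"
    using opt_card_no_line_violation[of "d - Suc s" d n g U L] g(2) r Suc.prems by simp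
  also have "?c g ?r \<le> ?c f ?r + 2 * card (X ?r)"
    using g(1) by (intro opt_card_potential_change finite_agree_pairs finX) simp
  finally have "?c f (d - Suc s) \<le> ?c f ?r + 4 * card (X ?r)" by simp
  also have "?c f ?r \<le> 4 * (\<Sum>r\<in>{?r<..d}. card (X r))" using Suc by simp
  finally have "?c f (d - Suc s) \<le> 4 * (card (X ?r) + (\<Sum>r\<in>{?r<..d}. card (X r)))" by simp
  also have "card (X ?r) + (\<Sum>r\<in>{?r<..d}. card (X r)) = (\<Sum>r\<in>insert ?r {?r<..d}. card (X r))"
    by simp
  also have "insert ?r {?r<..d} = {d - Suc s<..d}" using r Suc.prems by auto
  finally show ?case .
qed

text \<open>A violated pair avoiding the endpoints of an optimal matching could be added to it and
  would increase the weight. Each edge has two endpoints, which doubles the constant 4 to 8.\<close>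

lemma dimension_reduction:
  fixes f :: "(nat \<Rightarrow> nat) \<Rightarrow> real"
  assumes X: "\<And>r. r \<in> {1..d} \<Longrightarrow> X r \<subseteq> hypergrid n d"
    and line: "\<And>r x i. r \<in> {1..d} \<Longrightarrow> x \<in> hypergrid n d - X r \<Longrightarrow> x(r := i) \<in> hypergrid n d - X r \<Longrightarrow>
      f x - f (x(r := i)) \<le> line_dist U L r (x r) i"
  shows "\<exists>C \<subseteq> hypergrid n d. card C \<le> 8 * (\<Sum>r\<in>{1..d}. card (X r)) \<and>
    (\<forall>x\<in>hypergrid n d - C. \<forall>y\<in>hypergrid n d - C. f x - f y \<le> grid_dist d U L x y)"
proof -
  let ?V = "hypergrid n d" and ?w = "\<lambda>x y. f x - f y - grid_dist d U L x y"
  let ?Q = "agree_pairs n d 0"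
  obtain M where M: "optimal ?Q ?w M"
    using optimal_exists[OF finite_agree_pairs] by blast
  have mM: "matching ?Q M" using M by (simp add: optimal_def)
  note D = matchingD[OF mM]
  have finM: "finite M" using D(1) finite_agree_pairs finite_subset by blast
  have "opt_card (agree_pairs n d (d - d)) ?w \<le> 4 * (\<Sum>r\<in>{d - d<..d}. card (X r))"
    using X line by (intro opt_card_agree_pairs_le) auto
  moreover have "{0<..d} = {1..d}" by auto
  ultimately have cM: "card M \<le> 4 * (\<Sum>r\<in>{1..d}. card (X r))"
    using opt_card_eqI[OF M] by simp
  define C where "C = Domain M \<union> Range M"
  have "card (Domain M) \<le> card M" "card (Range M) \<le> card M"
    using card_image_le[OF finM, of fst] card_image_le[OF finM, of snd]
    by (simp_all add: fst_eq_Domain snd_eq_Range)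
  then have "card C \<le> card M + card M"
    unfolding C_def using card_Un_le[of "Domain M" "Range M"] by linarith
  then have "card C \<le> 8 * (\<Sum>r\<in>{1..d}. card (X r))" using cM by linarith
  moreover have "C \<subseteq> ?V" using D(1) by (fastforce simp: C_def agree_pairs_def)
  moreover have "f x - f y \<le> grid_dist d U L x y" if "x \<in> ?V - C" "y \<in> ?V - C" for x y
  proof (rule ccontr)
    assume v: "\<not> ?thesis"
    have new: "(x, z) \<notin> M" "(z, y) \<notin> M" for z using that by (auto simp: C_def)
    have "matching ?Q (insert (x, y) M)"
    proof (rule matchingI)
      show "insert (x, y) M \<subseteq> ?Q" using D(1) that by (auto simp: agree_pairs_def)
    qed (use new D(2,3) in auto)
    then have "weight ?w (insert (x, y) M) \<le> weight ?w M"
      using M by (auto simp: optimal_def)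
    moreover have "weight ?w (insert (x, y) M) = ?w x y + weight ?w M"
      using finM new by (simp add: weight_def)
    ultimately show False using v by simp
  qed
  ultimately show ?thesis by blast
qed

section \<open>Violations on lines with erasures\<close>

definition dense_endpoints :: "nat set \<Rightarrow> nat \<Rightarrow> nat set" where
  "dense_endpoints S n = {i. \<exists>p q. 1 \<le> p \<and> p \<le> q \<and> q \<le> n \<and> (i = p \<or> i = q) \<and> q + 1 - p \<le> 2 * card (S \<inter> {p..q})}"

text \<open>Greedy covering from the left: if \<open>{a..q}\<close> is at least half filled by
  \<open>S\<close>, all its points are charged to the elements of \<open>S\<close> inside it and the
  count resumes at \<open>Suc q\<close>; otherwise \<open>a\<close> is skipped. Each element of
  \<open>S\<close> pays for at most two points.\<close>

lemma card_dense_left_endpoints: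
  "card {i\<in>{a..n}. \<exists>q\<in>{i..n}. q + 1 - i \<le> 2 * card (S \<inter> {i..q})} \<le> 2 * card (S \<inter> {a..n})"
proof (induction "n + 1 - a" arbitrary: a rule: less_induct)
  case less
  let ?P = "\<lambda>i. \<exists>q\<in>{i..n}. q + 1 - i \<le> 2 * card (S \<inter> {i..q})"
  show ?case
  proof (cases "a \<le> n")
    case False
    then show ?thesis by simp
  next
    case an: True
    show ?thesis
    proof (cases "?P a")
      case False
      then have "{i\<in>{a..n}. ?P i} = {i\<in>{Suc a..n}. ?P i}"
        by (force simp: Suc_le_eq order_le_less)
      then have "card {i\<in>{a..n}. ?P i} \<le> 2 * card (S \<inter> {Suc a..n})"
        using less[of "Suc a"] an by simp
      also have "card (S \<inter> {Suc a..n}) \<le> card (S \<inter> {a..n})" by (intro card_mono) auto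
      finally show ?thesis by simp
    next
      case True
      then obtain q where q: "q \<in> {a..n}" "q + 1 - a \<le> 2 * card (S \<inter> {a..q})" by blast
      have "{i\<in>{a..n}. ?P i} \<subseteq> {a..q} \<union> {i\<in>{Suc q..n}. ?P i}" by auto
      then have "card {i\<in>{a..n}. ?P i} \<le> card ({a..q} \<union> {i\<in>{Suc q..n}. ?P i})"
        by (intro card_mono) auto
      also have "\<dots> \<le> card {a..q} + card {i\<in>{Suc q..n}. ?P i}" by (rule card_Un_le)
      also have "card {a..q} \<le> 2 * card (S \<inter> {a..q})" using q by simp
      also have "card {i\<in>{Suc q..n}. ?P i} \<le> 2 * card (S \<inter> {Suc q..n})"
        using less[of "Suc q"] q an by auto
      also have "2 * card (S \<inter> {a..q}) + 2 * card (S \<inter> {Suc q..n}) = 2 * card (S \<inter> {a..q} \<union> S \<inter> {Suc q..n})"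
        by (subst card_Un_disjoint) auto
      also have "S \<inter> {a..q} \<union> S \<inter> {Suc q..n} = S \<inter> {a..n}" using q by auto
      finally show ?thesis by simp
    qed
  qed
qed

lemma card_dense_right_endpoints:
  "card {i\<in>{1..b}. \<exists>p\<in>{1..i}. i + 1 - p \<le> 2 * card (S \<inter> {p..i})} \<le> 2 * card (S \<inter> {1..b})"
proof (induction b rule: less_induct)
  case (less b)
  let ?P = "\<lambda>i. \<exists>p\<in>{1..i}. i + 1 - p \<le> 2 * card (S \<inter> {p..i})"
  show ?case
  proof (cases "1 \<le> b \<and> ?P b")
    case False
    show ?thesis
    proof (cases "b = 0")
      case True
      then show ?thesis by simp
    next
      case b: False
      then have "{i\<in>{1..b}. ?P i} = {i\<in>{1..b - 1}. ?P i}"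
        using False by (force simp: order_le_less)
      then have "card {i\<in>{1..b}. ?P i} \<le> 2 * card (S \<inter> {1..b - 1})"
        using less[of "b - 1"] b by simp
      also have "card (S \<inter> {1..b - 1}) \<le> card (S \<inter> {1..b})" by (intro card_mono) auto
      finally show ?thesis by simp
    qed
  next
    case True
    then obtain p where p: "p \<in> {1..b}" "b + 1 - p \<le> 2 * card (S \<inter> {p..b})" by blast
    have "{i\<in>{1..b}. ?P i} \<subseteq> {p..b} \<union> {i\<in>{1..p - 1}. ?P i}" by auto
    then have "card {i\<in>{1..b}. ?P i} \<le> card ({p..b} \<union> {i\<in>{1..p - 1}. ?P i})"
      by (intro card_mono) auto
    also have "\<dots> \<le> card {p..b} + card {i\<in>{1..p - 1}. ?P i}" by (rule card_Un_le)
    also have "card {p..b} \<le> 2 * card (S \<inter> {p..b})" using p by simp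
    also have "card {i\<in>{1..p - 1}. ?P i} \<le> 2 * card (S \<inter> {1..p - 1})"
      using less[of "p - 1"] p by auto
    also have "2 * card (S \<inter> {p..b}) + 2 * card (S \<inter> {1..p - 1}) = 2 * card (S \<inter> {p..b} \<union> S \<inter> {1..p - 1})"
      using p by (subst card_Un_disjoint) auto
    also have "S \<inter> {p..b} \<union> S \<inter> {1..p - 1} = S \<inter> {1..b}" using p by auto
    finally show ?thesis by simp
  qed
qed

lemma dense_endpoints_subset: "dense_endpoints S n \<subseteq> {1..n}"
  by (auto simp: dense_endpoints_def)

lemma card_dense_endpoints: "card (dense_endpoints S n) \<le> 4 * card (S \<inter> {1..n})"
proof -
  let ?A = "{i\<in>{1..n}. \<exists>q\<in>{i..n}. q + 1 - i \<le> 2 * card (S \<inter> {i..q})}"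
  let ?B = "{i\<in>{1..n}. \<exists>p\<in>{1..i}. i + 1 - p \<le> 2 * card (S \<inter> {p..i})}"
  have "dense_endpoints S n \<subseteq> ?A \<union> ?B"
  proof
    fix i assume "i \<in> dense_endpoints S n"
    then obtain p q where "1 \<le> p" "p \<le> q" "q \<le> n" "i = p \<or> i = q" "q + 1 - p \<le> 2 * card (S \<inter> {p..q})"
      unfolding dense_endpoints_def by blast
    then show "i \<in> ?A \<union> ?B" by auto
  qed
  then have "card (dense_endpoints S n) \<le> card (?A \<union> ?B)" by (intro card_mono) auto
  also have "\<dots> \<le> card ?A + card ?B" by (rule card_Un_le)
  also have "\<dots> \<le> 4 * card (S \<inter> {1..n})"
    using card_dense_left_endpoints[of 1 n S] card_dense_right_endpoints[of n S] by linarith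
  finally show ?thesis .
qed

text \<open>At some dyadic scale and on one side, at least an eighth of the offsets lead to a
  nonerased violating partner. Truncated subtraction sends offsets that leave the line on the left
  to 0, which is no grid coordinate and so not in the sets \<open>G\<close> used later.\<close>

definition bad_position :: "nat \<Rightarrow> nat set \<Rightarrow> (nat \<Rightarrow> nat \<Rightarrow> bool) \<Rightarrow> nat \<Rightarrow> bool" where
  "bad_position K G v i \<longleftrightarrow> (\<exists>k\<le>K.
     2 ^ k \<le> 8 * card {t\<in>{1..2 ^ k}. i + t \<in> G \<and> v i (i + t)} \<or>
     2 ^ k \<le> 8 * card {t\<in>{1..2 ^ k}. i - t \<in> G \<and> v i (i - t)})"

text \<open>Fewer than half of \<open>{i..j}\<close> is erased, and by \<open>between\<close> each
  nonerased point there violates with \<open>i\<close> or with \<open>j\<close>. Hence one endpoint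
  violates with more than a quarter of the interval; passing to the enclosing dyadic scale loses
  another factor two.\<close>

lemma violation_imp_bad_position:
  assumes ij: "i < j" "i \<in> {1..n}" "j \<in> {1..n}" and n: "n \<le> 2 ^ K"
    and nd: "i \<notin> dense_endpoints ({1..n} - G) n" "j \<notin> dense_endpoints ({1..n} - G) n"
    and v: "v i j" and irr: "\<And>i. \<not> v i i"
    and between: "\<And>k. k \<in> {i..j} \<Longrightarrow> v i k \<or> v j k"
  shows "bad_position K G v i \<or> bad_position K G v j"
proof -
  have nd': "\<not> (j + 1 - i \<le> 2 * card (({1..n} - G) \<inter> {i..j}))"
    using nd(1) ij unfolding dense_endpoints_def by auto
  define A where "A = {k\<in>{i..j}. k \<in> G \<and> v i k}"
  define B where "B = {k\<in>{i..j}. k \<in> G \<and> v j k}"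
  have "{i..j} \<subseteq> (({1..n} - G) \<inter> {i..j}) \<union> (A \<union> B)"
  proof
    fix k assume k: "k \<in> {i..j}"
    with between have "v i k \<or> v j k" by blast
    then show "k \<in> (({1..n} - G) \<inter> {i..j}) \<union> (A \<union> B)" using ij k by (auto simp: A_def B_def)
  qed
  then have "card {i..j} \<le> card ((({1..n} - G) \<inter> {i..j}) \<union> (A \<union> B))"
    by (intro card_mono) (auto simp: A_def B_def)
  also have "\<dots> \<le> card (({1..n} - G) \<inter> {i..j}) + (card A + card B)"
    by (meson add_left_mono card_Un_le le_trans)
  finally have "j + 1 - i \<le> card (({1..n} - G) \<inter> {i..j}) + (card A + card B)" by simp
  with nd' have AB: "j + 1 - i < 4 * card A \<or> j + 1 - i < 4 * card B" by arith
  \<comment> \<open>The smallest scale that reaches \<open>j\<close> from \<open>i\<close>;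
    minimality gives \<open>2 ^ k \<le> 2 * (j - i)\<close>, with scale 0 covered by
    \<open>i < j\<close>.\<close>
  define k where "k = (LEAST k. j - i \<le> 2 ^ k)"
  have kK: "j - i \<le> 2 ^ K" using ij n by auto
  have k1: "j - i \<le> 2 ^ k" unfolding k_def by (rule LeastI[of _ K]) (rule kK)
  have k2: "k \<le> K" unfolding k_def by (rule Least_le) (rule kK)
  have k3: "2 ^ k \<le> 2 * (j - i)"
  proof (cases k)
    case 0
    then show ?thesis using ij by simp
  next
    case (Suc k')
    then have "\<not> j - i \<le> 2 ^ k'" using not_less_Least[of k' "\<lambda>k. j - i \<le> 2 ^ k"] by (simp add: k_def)
    then show ?thesis using Suc by simp
  qed
  from AB show ?thesis
  proof
    assume "j + 1 - i < 4 * card A"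
    also have "card A \<le> card {t\<in>{1..2 ^ k}. i + t \<in> G \<and> v i (i + t)}"
    proof (rule card_inj_on_le[where f = "\<lambda>q. q - i"])
      show "inj_on (\<lambda>q. q - i) A" by (auto simp: inj_on_def A_def)
      show "(\<lambda>q. q - i) ` A \<subseteq> {t\<in>{1..2 ^ k}. i + t \<in> G \<and> v i (i + t)}"
      proof (rule image_subsetI)
        fix q assume q: "q \<in> A"
        then have "q \<noteq> i" using irr by (auto simp: A_def)
        then show "q - i \<in> {t\<in>{1..2 ^ k}. i + t \<in> G \<and> v i (i + t)}" using q k1 by (auto simp: A_def)
      qed
    qed simp
    finally show ?thesis using k2 k3 unfolding bad_position_def by (intro disjI1 exI[of _ k]) linarith
  next
    assume "j + 1 - i < 4 * card B"
    also have "card B \<le> card {t\<in>{1..2 ^ k}. j - t \<in> G \<and> v j (j - t)}"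
    proof (rule card_inj_on_le[where f = "\<lambda>q. j - q"])
      show "inj_on (\<lambda>q. j - q) B" by (auto simp: inj_on_def B_def)
      show "(\<lambda>q. j - q) ` B \<subseteq> {t\<in>{1..2 ^ k}. j - t \<in> G \<and> v j (j - t)}"
      proof (rule image_subsetI)
        fix q assume q: "q \<in> B"
        then have "q \<noteq> j" using irr by (auto simp: B_def)
        then show "j - q \<in> {t\<in>{1..2 ^ k}. j - t \<in> G \<and> v j (j - t)}" using q k1 by (auto simp: B_def)
      qed
    qed simp
    finally show ?thesis using k2 k3 unfolding bad_position_def by (intro disjI2 exI[of _ k]) linarith
  qed
qed

section \<open>From single lines to the grid\<close>

lemma card_by_lines:
  assumes S: "S \<subseteq> hypergrid n d" and r: "r \<in> {1..d}"
  shows "card S = (\<Sum>z\<in>(\<lambda>x. x(r := 0)) ` hypergrid n d. card {i\<in>{1..n}. z(r := i) \<in> S})"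
proof -
  let ?Z = "(\<lambda>x. x(r := 0)) ` hypergrid n d"
  have "bij_betw (\<lambda>x. (x(r := 0), x r)) S (SIGMA z:?Z. {i\<in>{1..n}. z(r := i) \<in> S})"
  proof (rule bij_betwI[where g = "\<lambda>(z, i). z(r := i)"])
    show "(\<lambda>x. (x(r := 0), x r)) \<in> S \<rightarrow> (SIGMA z:?Z. {i\<in>{1..n}. z(r := i) \<in> S})"
      using S hypergrid_coord[OF _ r] by fastforce
  qed auto
  then have "card S = card (SIGMA z:?Z. {i\<in>{1..n}. z(r := i) \<in> S})" by (rule bij_betw_same_card)
  then show ?thesis by (simp add: finite_hypergrid)
qed

text \<open>\<open>N\<close> is the set of nonerased points, and \<open>v x y\<close> states that the pair \<open>x, y\<close> is violated.\<close>

definition dense_points :: "nat \<Rightarrow> nat \<Rightarrow> (nat \<Rightarrow> nat) set \<Rightarrow> nat \<Rightarrow> (nat \<Rightarrow> nat) set" where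
  "dense_points n d N r = {x\<in>hypergrid n d. x r \<in> dense_endpoints {i\<in>{1..n}. x(r := i) \<notin> N} n}"

definition bad_points ::
    "nat \<Rightarrow> (nat \<Rightarrow> nat) set \<Rightarrow> ((nat \<Rightarrow> nat) \<Rightarrow> (nat \<Rightarrow> nat) \<Rightarrow> bool) \<Rightarrow> nat \<Rightarrow> (nat \<Rightarrow> nat) set" where
  "bad_points K N v r =
     {x\<in>N. bad_position K {i. x(r := i) \<in> N} (\<lambda>i j. v (x(r := i)) (x(r := j))) (x r)}"

lemma card_dense_points:
  assumes r: "r \<in> {1..d}"
  shows "card (dense_points n d N r) \<le> 4 * card (hypergrid n d - N)"
proof -
  let ?V = "hypergrid n d" and ?Z = "(\<lambda>x. x(r := 0)) ` hypergrid n d"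
  have "card (dense_points n d N r) = (\<Sum>z\<in>?Z. card {i\<in>{1..n}. z(r := i) \<in> dense_points n d N r})"
    by (rule card_by_lines[OF _ r]) (auto simp: dense_points_def)
  also have "\<dots> \<le> (\<Sum>z\<in>?Z. 4 * card {i\<in>{1..n}. z(r := i) \<in> ?V - N})"
  proof (rule sum_mono)
    fix z assume "z \<in> ?Z"
    then have zV: "z(r := i) \<in> ?V" if "i \<in> {1..n}" for i using hypergrid_upd[OF _ r that] by auto
    let ?S = "{i\<in>{1..n}. z(r := i) \<notin> N}"
    have "{i\<in>{1..n}. z(r := i) \<in> dense_points n d N r} \<subseteq> dense_endpoints ?S n"
      by (auto simp: dense_points_def)
    then have "card {i\<in>{1..n}. z(r := i) \<in> dense_points n d N r} \<le> card (dense_endpoints ?S n)"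
      by (intro card_mono finite_subset[OF dense_endpoints_subset]) auto
    also have "\<dots> \<le> 4 * card (?S \<inter> {1..n})" by (rule card_dense_endpoints)
    also have "?S \<inter> {1..n} = {i\<in>{1..n}. z(r := i) \<in> ?V - N}" using zV by auto
    finally show "card {i\<in>{1..n}. z(r := i) \<in> dense_points n d N r} \<le>
      4 * card {i\<in>{1..n}. z(r := i) \<in> ?V - N}" .
  qed
  also have "\<dots> = 4 * card (?V - N)"
    by (subst card_by_lines[OF _ r, of "?V - N" n]) (auto simp: sum_distrib_left)
  finally show ?thesis .
qed

text \<open>The statement for one line, applied with \<open>G\<close> the set of nonerased
  positions. The points kept are automatically nonerased, so not being in \<open>bad_points\<close>
  does mean that their position is not bad.\<close>

lemma line_violation_imp_bad_or_dense:
  assumes r: "r \<in> {1..d}" and n: "n \<le> 2 ^ K"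
    and irr: "\<And>x. \<not> v x x" and sym: "\<And>x y. v x y \<Longrightarrow> v y x"
    and between: "\<And>x i j k. x \<in> hypergrid n d \<Longrightarrow> 1 \<le> i \<Longrightarrow> i \<le> k \<Longrightarrow> k \<le> j \<Longrightarrow> j \<le> n \<Longrightarrow>
      v (x(r := i)) (x(r := j)) \<Longrightarrow> v (x(r := i)) (x(r := k)) \<or> v (x(r := k)) (x(r := j))"
    and x: "x \<in> hypergrid n d - (bad_points K N v r \<union> dense_points n d N r)"
    and y: "x(r := j) \<in> hypergrid n d - (bad_points K N v r \<union> dense_points n d N r)"
  shows "\<not> v x (x(r := j))"
proof
  assume vxy: "v x (x(r := j))"
  let ?V = "hypergrid n d"
  define i where "i = x r"
  have xi: "x(r := i) = x" by (simp add: i_def)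
  have ij: "i \<in> {1..n}" "j \<in> {1..n}"
    using hypergrid_coord[OF _ r, of x n] hypergrid_coord[OF _ r, of "x(r := j)" n] x y by (auto simp: i_def)
  define G where "G = {q. x(r := q) \<in> N}"
  have S: "{1..n} - G = {q\<in>{1..n}. x(r := q) \<notin> N}" by (auto simp: G_def)
  have nd: "i \<notin> dense_endpoints ({1..n} - G) n" "j \<notin> dense_endpoints ({1..n} - G) n"
    using x y unfolding S by (auto simp: dense_points_def i_def)
  \<comment> \<open>An erased position is an endpoint of the half-erased interval
    \<open>{q..q}\<close>.\<close>
  have inG: "q \<in> G" if "q \<in> {1..n}" "q \<notin> dense_endpoints ({1..n} - G) n" for q
  proof (rule ccontr)
    assume "q \<notin> G"
    then have "({1..n} - G) \<inter> {q..q} = {q}" using that by auto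
    then show False using that unfolding dense_endpoints_def by force
  qed
  let ?v = "\<lambda>p q. v (x(r := p)) (x(r := q))"
  have nb: "\<not> bad_position K G ?v i" "\<not> bad_position K G ?v j"
    using x y inG[OF ij(1) nd(1)] inG[OF ij(2) nd(2)] by (auto simp: bad_points_def i_def G_def)
  have v': "?v i j" "?v j i" using vxy sym by (simp_all add: xi)
  have "i \<noteq> j" using v' irr by auto
  have btw: "?v p k \<or> ?v q k" if "?v p q" "p \<in> {1..n}" "q \<in> {1..n}" "k \<in> {p..q}" for p q k
    using between[of x p k q] that x sym by auto
  show False
  proof (cases "i < j")
    case True
    then show False
      using violation_imp_bad_position[OF True ij n nd, of ?v] v' irr btw[OF v'(1) ij] nb by blast
  next
    case False
    then have "j < i" using \<open>i \<noteq> j\<close> by simp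
    then show False
      using violation_imp_bad_position[OF _ ij(2,1) n nd(2,1), of ?v] v' irr btw[OF v'(2) ij(2,1)] nb by blast
  qed
qed

section \<open>Infinite bounds\<close>

definition prefix_sum :: "(nat \<Rightarrow> nat \<Rightarrow> real) \<Rightarrow> nat \<Rightarrow> nat \<Rightarrow> real" where
  "prefix_sum c r i = (\<Sum>t\<in>{1..<i}. c r t)"

abbreviation bound_dist :: "(nat \<Rightarrow> nat \<Rightarrow> real) \<Rightarrow> (nat \<Rightarrow> nat \<Rightarrow> real) \<Rightarrow> nat \<Rightarrow> nat \<Rightarrow> nat \<Rightarrow> real" where
  "bound_dist l u \<equiv> line_dist (prefix_sum u) (prefix_sum l)"

lemma prefix_sum_diff:
  assumes "1 \<le> i" "i \<le> j"
  shows "prefix_sum c r j - prefix_sum c r i = (\<Sum>t\<in>{i..<j}. c r t)"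
  using sum.atLeastLessThan_concat[OF assms, of "c r"] by (simp add: prefix_sum_def)

lemma bound_dist_up:
  assumes lu: "\<And>t. t \<in> {1..<n} \<Longrightarrow> l r t \<le> u r t" and ij: "1 \<le> j" "j \<le> i" "i \<le> n"
  shows "bound_dist l u r i j = (\<Sum>t\<in>{j..<i}. u r t)"
proof -
  have "(\<Sum>t\<in>{j..<i}. l r t) \<le> (\<Sum>t\<in>{j..<i}. u r t)" using ij by (intro sum_mono lu) auto
  then show ?thesis using ij by (simp add: line_dist_def prefix_sum_diff)
qed

lemma bound_dist_down:
  assumes lu: "\<And>t. t \<in> {1..<n} \<Longrightarrow> l r t \<le> u r t" and ij: "1 \<le> i" "i \<le> j" "j \<le> n"
  shows "bound_dist l u r i j = - (\<Sum>t\<in>{i..<j}. l r t)"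
proof -
  have "(\<Sum>t\<in>{i..<j}. l r t) \<le> (\<Sum>t\<in>{i..<j}. u r t)" using ij by (intro sum_mono lu) auto
  moreover have "prefix_sum c r i - prefix_sum c r j = - (\<Sum>t\<in>{i..<j}. c r t)" for c
    using prefix_sum_diff[OF ij(1,2), of c r] by linarith
  ultimately show ?thesis by (simp add: line_dist_def)
qed

text \<open>Along a line the distance is additive over an intermediate point, not merely
  subadditive; this passes a violation on to one of the two parts.\<close>

lemma bound_dist_add:
  assumes lu: "\<And>t. t \<in> {1..<n} \<Longrightarrow> l r t \<le> u r t" and ij: "1 \<le> i" "i \<le> k" "k \<le> j" "j \<le> n"
  shows "bound_dist l u r i j = bound_dist l u r i k + bound_dist l u r k j"
    and "bound_dist l u r j i = bound_dist l u r j k + bound_dist l u r k i"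
proof -
  have s: "(\<Sum>t\<in>{i..<j}. c r t) = (\<Sum>t\<in>{i..<k}. c r t) + (\<Sum>t\<in>{k..<j}. c r t)" for c :: "nat \<Rightarrow> nat \<Rightarrow> real"
    using ij by (simp add: sum.atLeastLessThan_concat)
  show "bound_dist l u r i j = bound_dist l u r i k + bound_dist l u r k j"
    using bound_dist_down[of n l r u, OF lu] ij s[of l] by simp
  show "bound_dist l u r j i = bound_dist l u r j k + bound_dist l u r k i"
    using bound_dist_up[of n l r u, OF lu] ij s[of u] by simp
qed

definition cap_upper :: "real \<Rightarrow> (nat \<Rightarrow> nat \<Rightarrow> ereal) \<Rightarrow> nat \<Rightarrow> nat \<Rightarrow> real" where
  "cap_upper b u r t = (if u r t = \<infinity> then b else real_of_ereal (u r t))"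

definition cap_lower :: "real \<Rightarrow> (nat \<Rightarrow> nat \<Rightarrow> ereal) \<Rightarrow> nat \<Rightarrow> nat \<Rightarrow> real" where
  "cap_lower b l r t = (if l r t = -\<infinity> then - b else real_of_ereal (l r t))"

text \<open>\<open>real_of_ereal\<close> maps infinite values to 0, so only the finite bounds of
  direction \<open>r\<close> contribute. The total tells how large a substitute for infinity has to
  be.\<close>

definition finite_part_sum ::
    "nat \<Rightarrow> (nat \<Rightarrow> nat \<Rightarrow> ereal) \<Rightarrow> (nat \<Rightarrow> nat \<Rightarrow> ereal) \<Rightarrow> nat \<Rightarrow> real" where
  "finite_part_sum n l u r = (\<Sum>t\<in>{1..<n}. \<bar>real_of_ereal (l r t)\<bar> + \<bar>real_of_ereal (u r t)\<bar>)"

lemma finite_part_sum_nonneg: "0 \<le> finite_part_sum n l u r"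
  unfolding finite_part_sum_def by (intro sum_nonneg add_nonneg_nonneg abs_ge_zero)

lemma cap_lower_le_cap_upper:
  assumes B: "bounding_family n d l u" and r: "r \<in> {1..d}" and t: "t \<in> {1..<n}"
    and b: "(\<Sum>r\<in>{1..d}. finite_part_sum n l u r) \<le> b"
  shows "cap_lower b l r t \<le> cap_upper b u r t"
proof -
  have "\<bar>real_of_ereal (l r t)\<bar> + \<bar>real_of_ereal (u r t)\<bar> \<le> finite_part_sum n l u r"
    unfolding finite_part_sum_def using t by (intro member_le_sum add_nonneg_nonneg abs_ge_zero) simp_all
  also have "\<dots> \<le> (\<Sum>r\<in>{1..d}. finite_part_sum n l u r)"
    using r by (intro member_le_sum) (auto simp: finite_part_sum_nonneg)
  finally have "\<bar>real_of_ereal (l r t)\<bar> + \<bar>real_of_ereal (u r t)\<bar> \<le> b" using b by simp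
  moreover have "l r t < u r t" using B r t by (simp add: bounding_family_def)
  ultimately show ?thesis
    by (cases "l r t"; cases "u r t") (auto simp: cap_upper_def cap_lower_def)
qed

text \<open>Adding \<open>e\<close> makes every term nonnegative, so the sum is at least its single
  large term; the correction is at most the total of \<open>e\<close>.\<close>

lemma sum_ge_of_large_term:
  fixes c e :: "nat \<Rightarrow> real"
  assumes A: "A \<subseteq> {1..<n}" and t0: "t0 \<in> A" "b \<le> c t0 + e t0"
    and c: "\<And>t. t \<in> A \<Longrightarrow> - e t \<le> c t" and e: "\<And>t. 0 \<le> e t"
  shows "b - (\<Sum>t\<in>{1..<n}. e t) \<le> (\<Sum>t\<in>A. c t)"
proof -
  have fin: "finite A" using A finite_subset by blast
  have "b \<le> c t0 + e t0" by (rule t0)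
  also have "\<dots> \<le> (\<Sum>t\<in>A. c t + e t)"
    using c by (intro member_le_sum[OF t0(1) _ fin]) force
  also have "\<dots> = (\<Sum>t\<in>A. c t) + (\<Sum>t\<in>A. e t)" by (rule sum.distrib)
  also have "(\<Sum>t\<in>A. e t) \<le> (\<Sum>t\<in>{1..<n}. e t)" using A e by (intro sum_mono2) auto
  finally show ?thesis by simp
qed

lemma sum_ereal_MInfty:
  fixes c :: "'a \<Rightarrow> ereal"
  assumes "finite A" "i \<in> A" "c i = -\<infinity>" "\<And>j. j \<in> A \<Longrightarrow> c j \<noteq> \<infinity>"
  shows "sum c A = -\<infinity>"
proof -
  have "sum c (A - {i}) \<noteq> \<infinity>" using assms by (auto simp: sum_Pinfty)
  then show ?thesis using assms by (simp add: sum.remove[of A i])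
qed

lemma sum_ereal_not_MInfty:
  fixes c :: "'a \<Rightarrow> ereal"
  assumes "\<And>j. j \<in> A \<Longrightarrow> c j \<noteq> -\<infinity>"
  shows "sum c A \<noteq> -\<infinity>"
  using assms by (induction A rule: infinite_finite_induct) auto

text \<open>
  On a fixed function, infinite bounds act like sufficiently large finite ones.
\<close>

lemma bounding_dist_cap:
  assumes B: "bounding_family n d l u" and b: "(\<Sum>r\<in>{1..d}. finite_part_sum n l u r) \<le> b"
    and x: "x \<in> hypergrid n d" and y: "y \<in> hypergrid n d"
  defines "m \<equiv> grid_dist d (prefix_sum (cap_upper b u)) (prefix_sum (cap_lower b l)) x y"
  shows "bounding_dist d l u x y = ereal m \<or>
    bounding_dist d l u x y = \<infinity> \<and> b - (\<Sum>r\<in>{1..d}. finite_part_sum n l u r) \<le> m"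
proof -
  let ?u = "cap_upper b u" and ?l = "cap_lower b l" and ?F = "finite_part_sum n l u"
  let ?bd = "\<lambda>r. bound_dist ?l ?u r (x r) (y r)"
  have x': "x r \<in> {1..n}" if "r \<in> {1..d}" for r using hypergrid_coord[OF x that] .
  have y': "y r \<in> {1..n}" if "r \<in> {1..d}" for r using hypergrid_coord[OF y that] .
  have b0: "0 \<le> b" using b sum_nonneg[of "{1..d}" ?F] finite_part_sum_nonneg by force
  have lu: "?l r t \<le> ?u r t" if "r \<in> {1..d}" "t \<in> {1..<n}" for r t
    by (rule cap_lower_le_cap_upper[OF B that b])
  have up: "?bd r = (\<Sum>t\<in>{y r..<x r}. ?u r t)" if "r \<in> {1..d}" "y r < x r" for r
    using bound_dist_up[of n ?l r ?u "y r" "x r", OF lu] that x' y' by auto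
  have down: "?bd r = - (\<Sum>t\<in>{x r..<y r}. ?l r t)" if "r \<in> {1..d}" "x r < y r" for r
    using bound_dist_down[of n ?l r ?u "x r" "y r", OF lu] that x' y' by auto
  let ?Up = "{r\<in>{1..d}. x r > y r}" and ?Dn = "{r\<in>{1..d}. x r < y r}"
  have not_inf: "u r t \<noteq> -\<infinity>" "l r t \<noteq> \<infinity>" if "r \<in> {1..d}" "t \<in> {1..<n}" for r t
    using B that unfolding bounding_family_def by force+
  have tin: "{y r..<x r} \<subseteq> {1..<n}" "{x r..<y r} \<subseteq> {1..<n}" if "r \<in> {1..d}" for r
    using x'[OF that] y'[OF that] by auto
  show ?thesis
  proof (cases "(\<forall>r\<in>?Up. \<forall>t\<in>{y r..<x r}. u r t \<noteq> \<infinity>) \<and> (\<forall>r\<in>?Dn. \<forall>t\<in>{x r..<y r}. l r t \<noteq> -\<infinity>)")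
    case True
    have U: "u r t = ereal (?u r t)" if "r \<in> ?Up" "t \<in> {y r..<x r}" for r t
      using True that not_inf(1)[of r t] tin(1)[of r] by (cases "u r t") (auto simp: cap_upper_def)
    have L: "l r t = ereal (?l r t)" if "r \<in> ?Dn" "t \<in> {x r..<y r}" for r t
      using True that not_inf(2)[of r t] tin(2)[of r] by (cases "l r t") (auto simp: cap_lower_def)
    have "bounding_dist d l u x y = (\<Sum>r\<in>?Up. \<Sum>t\<in>{y r..<x r}. ereal (?u r t))
        - (\<Sum>r\<in>?Dn. \<Sum>t\<in>{x r..<y r}. ereal (?l r t))"
      unfolding bounding_dist_def using U L by (intro arg_cong2[of _ _ _ _ minus] sum.cong) auto
    also have "\<dots> = ereal ((\<Sum>r\<in>?Up. ?bd r) + (\<Sum>r\<in>?Dn. ?bd r))"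
      using up down by (simp add: sum_negf)
    also have "(\<Sum>r\<in>?Up. ?bd r) + (\<Sum>r\<in>?Dn. ?bd r) = (\<Sum>r\<in>?Up \<union> ?Dn. ?bd r)"
      by (subst sum.union_disjoint) auto
    also have "\<dots> = m"
    proof -
      have "?bd r = 0" if "r \<in> {1..d} - (?Up \<union> ?Dn)" for r
      proof -
        have "x r = y r" using that by auto
        then show ?thesis by (simp add: line_dist_refl)
      qed
      then show ?thesis
        unfolding m_def grid_dist_def by (intro sum.mono_neutral_left ballI) auto
    qed
    finally show ?thesis by simp
  next
    case False
    \<comment> \<open>Every coordinate contributes at least minus its finite part; a coordinate
      \<open>r0\<close> with an infinite bound on the way from \<open>x\<close> to \<open>y\<close>
      contributes \<open>b\<close> in addition.\<close>
    have ge: "b * of_bool (r = r0) - ?F r \<le> ?bd r"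
      if r: "r \<in> {1..d}" and r0: "r = r0 \<Longrightarrow> r \<in> ?Up \<and> (\<exists>t\<in>{y r..<x r}. u r t = \<infinity>) \<or>
        r \<in> ?Dn \<and> (\<exists>t\<in>{x r..<y r}. l r t = -\<infinity>)" for r r0
    proof -
      let ?e = "\<lambda>t. \<bar>real_of_ereal (l r t)\<bar> + \<bar>real_of_ereal (u r t)\<bar>"
      have cu: "- ?e t \<le> ?u r t" "- ?e t \<le> - ?l r t" for t
        using b0 abs_ge_zero[of "real_of_ereal (l r t)"] abs_ge_zero[of "real_of_ereal (u r t)"]
          abs_ge_self[of "real_of_ereal (l r t)"] abs_ge_minus_self[of "real_of_ereal (u r t)"]
        by (auto simp: cap_upper_def cap_lower_def simp del: abs_real_of_ereal abs_ge_zero)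
      consider "y r < x r" | "x r < y r" | "x r = y r" by linarith
      then show ?thesis
      proof cases
        case 1
        obtain t0 where t0: "t0 \<in> {y r..<x r}" "b * of_bool (r = r0) \<le> ?u r t0 + ?e t0"
        proof (cases "r = r0")
          case True
          then obtain t where t: "t \<in> {y r..<x r}" "u r t = \<infinity>" using r0 1 by auto
          show thesis
            by (rule that[OF t(1)]) (use True t(2) in \<open>simp add: cap_upper_def del: abs_real_of_ereal\<close>)
        next
          case False
          then show thesis using that[of "y r"] cu(1)[of "y r"] 1 by simp
        qed
        show ?thesis unfolding up[OF r 1] finite_part_sum_def
          by (rule sum_ge_of_large_term[where e = ?e, OF tin(1)[OF r] t0(1)])
            (use t0(2) cu in \<open>auto simp del: abs_real_of_ereal\<close>)
      next
        case 2
        obtain t0 where t0: "t0 \<in> {x r..<y r}" "b * of_bool (r = r0) \<le> - ?l r t0 + ?e t0"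
        proof (cases "r = r0")
          case True
          then obtain t where t: "t \<in> {x r..<y r}" "l r t = -\<infinity>" using r0 2 by auto
          show thesis
            by (rule that[OF t(1)]) (use True t(2) in \<open>simp add: cap_lower_def del: abs_real_of_ereal\<close>)
        next
          case False
          then show thesis using that[of "x r"] cu(2)[of "x r"] 2 by simp
        qed
        show ?thesis unfolding down[OF r 2] finite_part_sum_def sum_negf[symmetric]
          by (rule sum_ge_of_large_term[where e = ?e, OF tin(2)[OF r] t0(1)])
            (use t0(2) cu in \<open>auto simp del: abs_real_of_ereal\<close>)
      next
        case 3
        then have "r \<noteq> r0" using r0 by auto
        then show ?thesis using 3 finite_part_sum_nonneg[of n l u r] by (simp add: line_dist_refl)
      qed
    qed
    obtain r0 where r0: "r0 \<in> {1..d}" "r0 \<in> ?Up \<and> (\<exists>t\<in>{y r0..<x r0}. u r0 t = \<infinity>) \<or>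
        r0 \<in> ?Dn \<and> (\<exists>t\<in>{x r0..<y r0}. l r0 t = -\<infinity>)"
      using False by blast
    have "(\<Sum>r\<in>{1..d}. b * of_bool (r = r0) - ?F r) \<le> m"
      unfolding m_def grid_dist_def using r0(2) by (intro sum_mono ge) blast+
    moreover have "(\<Sum>r\<in>{1..d}. b * of_bool (r = r0) - ?F r) = b - (\<Sum>r\<in>{1..d}. ?F r)"
    proof -
      have "(\<Sum>r\<in>{1..d}. b * of_bool (r = r0)) = (\<Sum>r\<in>{1..d}. if r = r0 then b else 0)"
        by (intro sum.cong) auto
      also have "\<dots> = b" using r0(1) by simp
      finally show ?thesis unfolding sum_subtractf by simp
    qed
    moreover have "bounding_dist d l u x y = \<infinity>"
    proof -
      let ?A = "\<Sum>r\<in>?Up. \<Sum>t\<in>{y r..<x r}. u r t" and ?B = "\<Sum>r\<in>?Dn. \<Sum>t\<in>{x r..<y r}. l r t"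
      \<comment> \<open>Together with \<open>B\<close> below, this keeps the difference from
        becoming \<open>\<infinity> - \<infinity>\<close>.\<close>
      have A: "?A \<noteq> -\<infinity>" using not_inf(1) tin(1) by (intro sum_ereal_not_MInfty) blast
      have Br: "(\<Sum>t\<in>{x r..<y r}. l r t) \<noteq> \<infinity>" if "r \<in> ?Dn" for r
        using not_inf(2)[of r] tin(2)[of r] that by (auto simp: sum_Pinfty)
      have B: "?B \<noteq> \<infinity>" using Br by (auto simp: sum_Pinfty simp del: mem_Collect_eq)
      from r0(2) have "?A = \<infinity> \<or> ?B = -\<infinity>"
      proof
        assume "r0 \<in> ?Up \<and> (\<exists>t\<in>{y r0..<x r0}. u r0 t = \<infinity>)"
        then show ?thesis by (intro disjI1) (auto simp: sum_Pinfty)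
      next
        assume r: "r0 \<in> ?Dn \<and> (\<exists>t\<in>{x r0..<y r0}. l r0 t = -\<infinity>)"
        then obtain t where t: "t \<in> {x r0..<y r0}" "l r0 t = -\<infinity>" by blast
        have "(\<Sum>t\<in>{x r0..<y r0}. l r0 t) = -\<infinity>"
          using not_inf(2)[OF r0(1)] tin(2)[OF r0(1)]
          by (intro sum_ereal_MInfty[where c = "l r0", OF _ t]) auto
        then have "?B = -\<infinity>"
          using Br r by (intro sum_ereal_MInfty[of ?Dn r0]) auto
        then show ?thesis ..
      qed
      then show ?thesis unfolding bounding_dist_def using A B
        by (cases ?A; cases ?B) auto
    qed
    ultimately show ?thesis by simp
  qed
qed

section \<open>The pair tester\<close>

definition violated :: "('a \<Rightarrow> 'a \<Rightarrow> real) \<Rightarrow> ('a \<Rightarrow> real) \<Rightarrow> 'a \<Rightarrow> 'a \<Rightarrow> bool" where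
  "violated m f x y \<longleftrightarrow> m x y < f x - f y \<or> m y x < f y - f x"

text \<open>By additivity, if both parts satisfied their bounds, adding these would give the bounds
  for the whole pair.\<close>

lemma violated_between:
  assumes lu: "\<And>t. t \<in> {1..<n} \<Longrightarrow> l r t \<le> u r t" and r: "r \<in> {1..d}"
    and ij: "1 \<le> i" "i \<le> k" "k \<le> j" "j \<le> n"
    and v: "violated (grid_dist d (prefix_sum u) (prefix_sum l)) f (x(r := i)) (x(r := j))"
  shows "violated (grid_dist d (prefix_sum u) (prefix_sum l)) f (x(r := i)) (x(r := k)) \<or>
    violated (grid_dist d (prefix_sum u) (prefix_sum l)) f (x(r := k)) (x(r := j))"
proof -
  have m: "grid_dist d (prefix_sum u) (prefix_sum l) (x(r := p)) (x(r := q)) = bound_dist l u r p q" for p q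
    using grid_dist_line[OF r, of "prefix_sum u" "prefix_sum l" "x(r := p)" q] by simp
  show ?thesis
    using v bound_dist_add[of n l r u i k j, OF lu ij] unfolding violated_def m by linarith
qed

text \<open>Deleting bad and dense points removes all violations on lines, so few such points would
  put \<open>f\<close> close to the property. In each direction there are at most four dense points
  per erased one, which the bound on \<open>\<alpha>\<close> makes negligible; hence a far function
  has many bad points.\<close>

lemma sum_card_bad_points:
  fixes f :: "(nat \<Rightarrow> nat) \<Rightarrow> real" and l u :: "nat \<Rightarrow> nat \<Rightarrow> real" and d :: nat
  defines "m \<equiv> grid_dist d (prefix_sum u) (prefix_sum l)"
  assumes d: "1 \<le> d" and n: "n \<le> 2 ^ K" and N: "N \<subseteq> hypergrid n d"
    and lu: "\<And>r t. r \<in> {1..d} \<Longrightarrow> t \<in> {1..<n} \<Longrightarrow> l r t \<le> u r t"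
    and \<epsilon>: "0 < \<epsilon>" "\<epsilon> < 1" and \<alpha>: "\<alpha> \<le> \<epsilon> / (970 * real d)"
    and erased: "real (card (hypergrid n d - N)) \<le> \<alpha> * real (card (hypergrid n d))"
    and far: "\<And>g. (\<And>x y. g x - g y \<le> m x y) \<Longrightarrow> \<epsilon> * real (card N) \<le> real (card {x\<in>N. f x \<noteq> g x})"
  shows "\<epsilon> * real (card (hypergrid n d)) \<le> 9 * real (\<Sum>r\<in>{1..d}. card (bad_points K N (violated m f) r))"
proof -
  let ?V = "hypergrid n d" and ?v = "violated m f"
  let ?B = "bad_points K N ?v" and ?D = "dense_points n d N"
  define X where "X = (\<lambda>r. ?B r \<union> ?D r)"
  have finV: "finite ?V" by (rule finite_hypergrid)
  have XV: "X r \<subseteq> ?V" for r using N by (auto simp: X_def bad_points_def dense_points_def)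
  have line: "f x - f (x(r := i)) \<le> line_dist (prefix_sum u) (prefix_sum l) r (x r) i"
    if r: "r \<in> {1..d}" and x: "x \<in> ?V - X r" "x(r := i) \<in> ?V - X r" for r x i
  proof -
    have "\<not> ?v x (x(r := i))"
    proof (rule line_violation_imp_bad_or_dense[OF r n])
      show "\<not> ?v x x" for x by (simp add: violated_def m_def grid_dist_refl)
      show "?v x y \<Longrightarrow> ?v y x" for x y by (auto simp: violated_def)
      show "?v (x(r := i)) (x(r := k)) \<or> ?v (x(r := k)) (x(r := j))"
        if "1 \<le> i" "i \<le> k" "k \<le> j" "j \<le> n" "?v (x(r := i)) (x(r := j))" for x i j k
        using violated_between[of n l r u d i k j f x, OF lu[OF r] r] that unfolding m_def by blast
    qed (use x in \<open>auto simp: X_def\<close>)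
    then show ?thesis using grid_dist_line[OF r] by (simp add: violated_def m_def not_less)
  qed
  obtain C where C: "C \<subseteq> ?V" "card C \<le> 8 * (\<Sum>r\<in>{1..d}. card (X r))"
    and good: "\<And>x y. x \<in> ?V - C \<Longrightarrow> y \<in> ?V - C \<Longrightarrow> f x - f y \<le> m x y"
    using dimension_reduction[of d X n f "prefix_sum u" "prefix_sum l", OF XV line] unfolding m_def by blast
  \<comment> \<open>The values of \<open>f\<close> outside \<open>C\<close> extend to a function
    with the property, which can differ from \<open>f\<close> on the grid only inside
    \<open>C\<close>.\<close>
  obtain g where g: "\<And>x. x \<in> ?V - C \<Longrightarrow> g x = f x" "\<And>x y. g x - g y \<le> m x y"
    using quasimetric_extension[of "?V - C" m f] finV good
    by (auto simp: m_def grid_dist_refl grid_dist_triangle)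
  define b where "b = real (\<Sum>r\<in>{1..d}. card (?B r))"
  define e where "e = real (card (?V - N))"
  define v where "v = real (card ?V)"
  have "{x\<in>N. f x \<noteq> g x} \<subseteq> C" using g(1) N by fastforce
  then have "card {x\<in>N. f x \<noteq> g x} \<le> card C"
    using C(1) finV by (intro card_mono) (auto intro: finite_subset)
  with far[OF g(2)] C(2) have "\<epsilon> * real (card N) \<le> 8 * real (\<Sum>r\<in>{1..d}. card (X r))"
    by linarith
  also have "real (\<Sum>r\<in>{1..d}. card (X r)) \<le> b + 4 * real d * e"
  proof -
    have "(\<Sum>r\<in>{1..d}. card (X r)) \<le> (\<Sum>r\<in>{1..d}. card (?B r) + 4 * card (?V - N))"
    proof (rule sum_mono)
      fix r assume "r \<in> {1..d}"
      then show "card (X r) \<le> card (?B r) + 4 * card (?V - N)"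
        using card_Un_le[of "?B r" "?D r"] card_dense_points[of r d n N] by (simp add: X_def)
    qed
    also have "\<dots> = (\<Sum>r\<in>{1..d}. card (?B r)) + 4 * d * card (?V - N)" by (simp add: sum.distrib)
    finally have "real (\<Sum>r\<in>{1..d}. card (X r)) \<le> real ((\<Sum>r\<in>{1..d}. card (?B r)) + 4 * d * card (?V - N))"
      by (rule of_nat_mono)
    then show ?thesis by (simp add: b_def e_def)
  qed
  finally have 1: "\<epsilon> * real (card N) \<le> 8 * b + 32 * (real d * e)" by simp
  have N_card: "real (card N) = v - e"
    using N finV by (simp add: v_def e_def card_Diff_subset finite_subset card_mono of_nat_diff)
  have v0: "0 \<le> v" and e0: "0 \<le> e" by (simp_all add: v_def e_def)
  have "e \<le> \<epsilon> / (970 * real d) * v"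
    using erased mult_right_mono[OF \<alpha> v0] unfolding e_def v_def by linarith
  then have "real d * e \<le> real d * (\<epsilon> / (970 * real d) * v)" using d by (intro mult_left_mono) auto
  also have "\<dots> = \<epsilon> * v / 970" using d by (simp add: field_simps)
  finally have de: "real d * e \<le> \<epsilon> * v / 970" .
  have "\<epsilon> * e \<le> 1 * e" using \<epsilon> e0 by (intro mult_right_mono) auto
  also have "\<dots> \<le> real d * e" using d e0 by (intro mult_right_mono) auto
  finally have ee: "\<epsilon> * e \<le> \<epsilon> * v / 970" using de by linarith
  have "\<epsilon> * v = \<epsilon> * real (card N) + \<epsilon> * e" by (simp add: N_card algebra_simps)
  \<comment> \<open>The dense points cost 32 units of \<open>\<epsilon> * v / 970\<close> and the
    erased points missing from \<open>N\<close> one more; the final constant 9 works because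
    \<open>8 / (1 - 33 / 970) < 9\<close>.\<close>
  then have "\<epsilon> * v \<le> 8 * b + 33 * (\<epsilon> * v / 970)" using 1 de ee by linarith
  moreover have "0 \<le> b" unfolding b_def by (rule of_nat_0_le_iff)
  ultimately have "\<epsilon> * v \<le> 9 * b" by linarith
  then show ?thesis by (simp add: b_def v_def)
qed

section \<open>Random probes and their detection probability\<close>

type_synonym probe = "(nat \<Rightarrow> nat) \<times> nat \<times> nat \<times> bool \<times> nat"

text \<open>The last component ranges over \<open>{..<2 ^ K}\<close> whatever the scale, so the
  space is a product and uniform sampling makes its components independent.\<close>

definition probe_space :: "nat \<Rightarrow> nat \<Rightarrow> nat \<Rightarrow> probe set" where
  "probe_space n d K = hypergrid n d \<times> {1..d} \<times> {..K} \<times> UNIV \<times> {..<2 ^ K}"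

text \<open>
  Reducing \<open>t\<close> modulo \<open>2\<^sup>k\<close> makes the offset uniform on \<open>{1..2\<^sup>k}\<close>.  A partner outside the grid is
  replaced by \<open>x\<close> itself.
\<close>

fun probe_pair :: "nat \<Rightarrow> nat \<Rightarrow> probe \<Rightarrow> (nat \<Rightarrow> nat) \<times> (nat \<Rightarrow> nat)" where
  "probe_pair n d (x, r, k, b, t) =
     (let s = t mod 2 ^ k + 1; y = x(r := if b then x r + s else x r - s)
      in (x, if y \<in> hypergrid n d then y else x))"

lemma finite_probe_space: "finite (probe_space n d K)"
  by (simp add: probe_space_def finite_hypergrid)

lemma card_probe_space: "card (probe_space n d K) = card (hypergrid n d) * (d * ((K + 1) * (2 * 2 ^ K)))"
  by (simp add: probe_space_def card_cartesian_product)

lemma probe_pair_in_hypergrid: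
  assumes "\<omega> \<in> probe_space n d K"
  shows "fst (probe_pair n d \<omega>) \<in> hypergrid n d" "snd (probe_pair n d \<omega>) \<in> hypergrid n d"
  using assms by (cases \<omega>; auto simp: probe_space_def Let_def)+

text \<open>Since \<open>2 ^ k\<close> divides \<open>2 ^ K\<close>, each offset in
  \<open>{1..2 ^ k}\<close> arises from \<open>2 ^ (K - k)\<close> values of \<open>t\<close>; the
  map \<open>g\<close> lists them.\<close>

lemma card_residues_ge:
  assumes A: "A \<subseteq> {1..2 ^ k}" and k: "k \<le> K"
  shows "card A * 2 ^ (K - k) \<le> card {t\<in>{..<2 ^ K}. t mod 2 ^ k + 1 \<in> (A :: nat set)}"
proof -
  define g where "g = (\<lambda>(a, q). (a - 1) + 2 ^ k * q :: nat)"
  have g: "g (a, q) mod 2 ^ k + 1 = a" "g (a, q) div 2 ^ k = q" if "a \<in> A" for a q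
  proof -
    have "1 \<le> a" "a \<le> 2 ^ k" using A that by auto
    then have "a - 1 < 2 ^ k" "a - 1 + 1 = a" by linarith+
    then show "g (a, q) mod 2 ^ k + 1 = a" "g (a, q) div 2 ^ k = q" by (simp_all only: g_def case_prod_conv mod_mult_self2 div_mult_self2 mod_less div_less)
  qed
  have "card (A \<times> {..<(2::nat) ^ (K - k)}) \<le> card {t\<in>{..<2 ^ K}. t mod 2 ^ k + 1 \<in> A}"
  proof (rule card_inj_on_le)
    show "inj_on g (A \<times> {..<(2::nat) ^ (K - k)})"
    proof (rule inj_onI)
      fix e e' assume "e \<in> A \<times> {..<(2::nat) ^ (K - k)}" "e' \<in> A \<times> {..<(2::nat) ^ (K - k)}" "g e = g e'"
      then show "e = e'"
        using g[of "fst e" "snd e"] g[of "fst e'" "snd e'"] by (auto simp: prod_eq_iff)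
    qed
    show "g ` (A \<times> {..<(2::nat) ^ (K - k)}) \<subseteq> {t\<in>{..<2 ^ K}. t mod 2 ^ k + 1 \<in> A}"
    proof (rule image_subsetI)
      fix e assume "e \<in> A \<times> {..<(2::nat) ^ (K - k)}"
      then obtain a q where e: "e = (a, q)" and a: "a \<in> A" and q: "q \<in> {..<(2::nat) ^ (K - k)}" by blast
      have "g (a, q) div 2 ^ k < 2 ^ (K - k)" using g(2)[OF a] q by simp
      then have "g (a, q) < 2 ^ (K - k) * 2 ^ k" by (simp add: div_less_iff_less_mult)
      also have "\<dots> = 2 ^ K" using k by (simp flip: power_add)
      finally show "g e \<in> {t\<in>{..<2 ^ K}. t mod 2 ^ k + 1 \<in> A}" unfolding e using g(1)[OF a] a by simp
    qed
  qed simp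
  then show ?thesis by (simp add: card_cartesian_product)
qed

text \<open>A bad point in direction \<open>r\<close> has a scale and a side at which at least an
  eighth of the values of \<open>t\<close> reveal a violation. Fixing one such choice for each point
  and direction makes the count injective.\<close>

lemma card_detecting_probes:
  assumes N: "N \<subseteq> hypergrid n d"
  shows "2 ^ K * (\<Sum>r\<in>{1..d}. card (bad_points K N v r)) \<le>
    8 * card {\<omega>\<in>probe_space n d K. fst (probe_pair n d \<omega>) \<in> N \<and> snd (probe_pair n d \<omega>) \<in> N \<and>
      v (fst (probe_pair n d \<omega>)) (snd (probe_pair n d \<omega>))}"
    (is "_ \<le> 8 * card ?G")
proof -
  let ?P = "\<lambda>x r k b t. let y = x(r := if b then x r + t else x r - t) in y \<in> N \<and> v x y"
  define S where "S = (\<lambda>x r k b. {t\<in>{1..2 ^ k}. ?P x r k b t})"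
  have "\<exists>k b. k \<le> K \<and> 2 ^ k \<le> 8 * card (S x r k b)" if "x \<in> bad_points K N v r" for x r
  proof -
    have "\<exists>k\<le>K. 2 ^ k \<le> 8 * card (S x r k True) \<or> 2 ^ k \<le> 8 * card (S x r k False)"
      using that by (simp add: S_def bad_points_def bad_position_def Let_def)
    then show ?thesis by blast
  qed
  then obtain k b where kb: "\<And>x r. x \<in> bad_points K N v r \<Longrightarrow> k x r \<le> K"
    "\<And>x r. x \<in> bad_points K N v r \<Longrightarrow> 2 ^ k x r \<le> 8 * card (S x r (k x r) (b x r))"
    by metis
  define A where "A = (\<lambda>x r. S x r (k x r) (b x r))"
  define T where "T = (\<lambda>x r. {t\<in>{..<2 ^ K}. t mod 2 ^ k x r + 1 \<in> A x r})"
  have cT: "2 ^ K \<le> 8 * card (T x r)" if x: "x \<in> bad_points K N v r" for x r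
  proof -
    have "A x r \<subseteq> {1..2 ^ k x r}" unfolding A_def S_def by blast
    from card_residues_ge[OF this kb(1)[OF x]]
    have A_le: "card (A x r) * 2 ^ (K - k x r) \<le> card (T x r)" by (simp only: T_def)
    have "(2::nat) ^ K = 2 ^ k x r * 2 ^ (K - k x r)" using kb(1)[OF x] by (simp flip: power_add)
    also have "\<dots> \<le> 8 * card (A x r) * 2 ^ (K - k x r)" using kb(2)[OF x] by (simp add: A_def)
    also have "\<dots> \<le> 8 * card (T x r)" using A_le by simp
    finally show ?thesis .
  qed
  have finB: "finite (bad_points K N v r)" for r
    by (rule finite_subset[OF _ finite_hypergrid[of n d]]) (use N in \<open>auto simp: bad_points_def\<close>)
  have finG: "finite ?G" using finite_probe_space by simp
  define U where "U = (SIGMA r:{1..d}. SIGMA x:bad_points K N v r. T x r)"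
  have "2 ^ K * (\<Sum>r\<in>{1..d}. card (bad_points K N v r)) = (\<Sum>r\<in>{1..d}. \<Sum>x\<in>bad_points K N v r. 2 ^ K)"
    by (simp add: sum_distrib_left mult.commute)
  also have "\<dots> \<le> (\<Sum>r\<in>{1..d}. \<Sum>x\<in>bad_points K N v r. 8 * card (T x r))"
    by (intro sum_mono cT)
  also have "\<dots> = 8 * card U"
    unfolding U_def using finB by (simp add: card_SigmaI T_def sum_distrib_left)
  also have "card U \<le> card ?G"
  proof (rule card_inj_on_le[OF _ _ finG])
    show "inj_on (\<lambda>(r, x, t). (x, r, k x r, b x r, t)) U" by (auto simp: inj_on_def)
    show "(\<lambda>(r, x, t). (x, r, k x r, b x r, t)) ` U \<subseteq> ?G"
    proof (rule image_subsetI)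
      fix e assume "e \<in> U"
      then obtain r x t where e: "e = (r, x, t)" and "(r, x, t) \<in> U" by (cases e) blast
      then have r: "r \<in> {1..d}" and x: "x \<in> bad_points K N v r" and t: "t \<in> T x r" by (auto simp: U_def)
      have xN: "x \<in> N" using x by (auto simp: bad_points_def)
      have A: "t mod 2 ^ k x r + 1 \<in> A x r" "t < 2 ^ K" using t by (auto simp: T_def)
      define y where "y = x(r := if b x r then x r + (t mod 2 ^ k x r + 1) else x r - (t mod 2 ^ k x r + 1))"
      have y: "y \<in> N" "v x y" using A(1) unfolding A_def S_def Let_def y_def by blast+
      have "probe_pair n d (x, r, k x r, b x r, t) = (x, y)"
      proof -
        have "y \<in> hypergrid n d" using y N by blast
        then show ?thesis unfolding probe_pair.simps Let_def y_def[symmetric] by simp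
      qed
      moreover have "(x, r, k x r, b x r, t) \<in> probe_space n d K"
        using xN N r kb(1)[OF x] A(2) by (auto simp: probe_space_def)
      ultimately show "(case e of (r, x, t) \<Rightarrow> (x, r, k x r, b x r, t)) \<in> ?G"
        using xN y by (simp add: e del: probe_pair.simps)
    qed
  qed
  finally show ?thesis by simp
qed

section \<open>Testing sampled pairs\<close>

primrec pair_alg ::
    "('a \<Rightarrow> 'a \<Rightarrow> real option \<Rightarrow> real option \<Rightarrow> bool) \<Rightarrow> ('a \<times> 'a) list \<Rightarrow> 'a query_alg" where
  "pair_alg c [] = Decide True"
| "pair_alg c (p # ps) = Query (fst p) (\<lambda>a. Query (snd p) (\<lambda>b.
     if c (fst p) (snd p) a b then Decide False else pair_alg c ps))"

lemma accepts_pair_alg: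
  "accepts (pair_alg c ps) f \<longleftrightarrow> (\<forall>p\<in>set ps. \<not> c (fst p) (snd p) (f (fst p)) (f (snd p)))"
  by (induction ps) auto

lemma num_queries_pair_alg: "num_queries (pair_alg c ps) f \<le> 2 * length ps"
  by (induction ps) auto

lemma query_points_pair_alg: "query_points (pair_alg c ps) \<subseteq> fst ` set ps \<union> snd ` set ps"
  by (induction ps) (auto split: if_splits)

text \<open>A uniform list of length \<open>s\<close> amounts to \<open>s\<close> independent
  uniform probes.\<close>

definition pair_tester ::
    "('a \<Rightarrow> 'a \<Rightarrow> real option \<Rightarrow> real option \<Rightarrow> bool) \<Rightarrow> ('w \<Rightarrow> 'a \<times> 'a) \<Rightarrow> 'w set \<Rightarrow> nat \<Rightarrow> 'a query_alg pmf" where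
  "pair_tester c h \<Omega> s =
     map_pmf (\<lambda>\<omega>s. pair_alg c (map h \<omega>s)) (pmf_of_set {\<omega>s. set \<omega>s \<subseteq> \<Omega> \<and> length \<omega>s = s})"

context
  fixes \<Omega> :: "'w set"
  assumes fin: "finite \<Omega>" and ne: "\<Omega> \<noteq> {}"
begin

lemma sample_lists:
  "finite {\<omega>s. set \<omega>s \<subseteq> \<Omega> \<and> length \<omega>s = s}" "{\<omega>s. set \<omega>s \<subseteq> \<Omega> \<and> length \<omega>s = s} \<noteq> {}"
proof -
  obtain \<omega> where "\<omega> \<in> \<Omega>" using ne by blast
  then have "replicate s \<omega> \<in> {\<omega>s. set \<omega>s \<subseteq> \<Omega> \<and> length \<omega>s = s}" by auto
  then show "{\<omega>s. set \<omega>s \<subseteq> \<Omega> \<and> length \<omega>s = s} \<noteq> {}" by blast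
qed (rule finite_lists_length_eq[OF fin])

lemma set_pair_tester:
  assumes "A \<in> set_pmf (pair_tester c h \<Omega> s)"
  obtains \<omega>s where "A = pair_alg c (map h \<omega>s)" "set \<omega>s \<subseteq> \<Omega>" "length \<omega>s = s"
  using assms sample_lists[of s] by (auto simp: pair_tester_def)

text \<open>The accepting lists are exactly the lists over the probes without conflict, so their
  number is a power.\<close>

lemma prob_pair_tester_accepts:
  "measure_pmf.prob (pair_tester c h \<Omega> s) {A. accepts A f} =
    (real (card {\<omega>\<in>\<Omega>. \<not> c (fst (h \<omega>)) (snd (h \<omega>)) (f (fst (h \<omega>))) (f (snd (h \<omega>)))}) / real (card \<Omega>)) ^ s"
proof -
  let ?S = "{\<omega>s. set \<omega>s \<subseteq> \<Omega> \<and> length \<omega>s = s}"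
  let ?G = "{\<omega>\<in>\<Omega>. \<not> c (fst (h \<omega>)) (snd (h \<omega>)) (f (fst (h \<omega>))) (f (snd (h \<omega>)))}"
  let ?A = "{\<omega>s. \<forall>\<omega>\<in>set \<omega>s. \<not> c (fst (h \<omega>)) (snd (h \<omega>)) (f (fst (h \<omega>))) (f (snd (h \<omega>)))}"
  have "measure_pmf.prob (pair_tester c h \<Omega> s) {A. accepts A f} = measure_pmf.prob (pmf_of_set ?S) ?A"
    by (simp add: pair_tester_def measure_map_pmf vimage_def accepts_pair_alg)
  also have "\<dots> = real (card (?S \<inter> ?A)) / real (card ?S)"
    by (rule measure_pmf_of_set) (rule sample_lists)+
  also have "?S \<inter> ?A = {\<omega>s. set \<omega>s \<subseteq> ?G \<and> length \<omega>s = s}" by auto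
  also have "card \<dots> = card ?G ^ s" using fin by (intro card_lists_length_eq) simp
  also have "card ?S = card \<Omega> ^ s" using fin by (rule card_lists_length_eq)
  finally show ?thesis by (simp add: power_divide)
qed

end

text \<open>Two revealed values are compared with the possibly infinite distance itself: the finite
  substitutes for infinite bounds depend on the input, hence belong to the analysis and not to the
  algorithm.\<close>

definition conflict :: "('a \<Rightarrow> 'a \<Rightarrow> ereal) \<Rightarrow> 'a \<Rightarrow> 'a \<Rightarrow> real option \<Rightarrow> real option \<Rightarrow> bool" where
  "conflict m x y a b \<longleftrightarrow>
     (\<exists>s t. a = Some s \<and> b = Some t \<and> \<not> (ereal (s - t) \<le> m x y \<and> ereal (t - s) \<le> m y x))"

text \<open>A restoration with the property agrees with all revealed values and thus excludes any
  conflict; this yields the one-sided error.\<close>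

lemma restorable_no_conflict:
  assumes "restorable D (bounded_derivative d l u D) f" "x \<in> D" "y \<in> D"
  shows "\<not> conflict (bounding_dist d l u) x y (f x) (f y)"
proof -
  obtain g where g: "restoration D f g" "g \<in> bounded_derivative d l u D"
    using assms(1) by (auto simp: restorable_def)
  have *: "g z = s" if "z \<in> D" "f z = Some s" for z s
    using g(1) that by (auto simp: restoration_def nonerased_def)
  have "ereal (g x - g y) \<le> bounding_dist d l u x y" "ereal (g y - g x) \<le> bounding_dist d l u y x"
    using g(2) assms(2,3) by (auto simp: bounded_derivative_def)
  then show ?thesis using *[OF assms(2)] *[OF assms(3)] by (auto simp: conflict_def)
qed

text \<open>The constant 144 collects 9 from the count of bad points, 8 from the detecting offsets
  and 2 from the choice of side; direction and scale account for the remaining factor.\<close>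

lemma card_conflicting_probes:
  fixes l u :: "nat \<Rightarrow> nat \<Rightarrow> ereal"
  assumes d: "1 \<le> d" and n: "1 \<le> n" "n \<le> 2 ^ K" and B: "bounding_family n d l u"
    and \<epsilon>: "0 < \<epsilon>" "\<epsilon> < 1" and \<alpha>: "\<alpha> \<le> \<epsilon> / (970 * real d)"
    and er: "erased (hypergrid n d) \<alpha> f"
    and far: "far (hypergrid n d) (bounded_derivative d l u (hypergrid n d)) \<epsilon> f"
  defines "G \<equiv> {\<omega>\<in>probe_space n d K. conflict (bounding_dist d l u)
    (fst (probe_pair n d \<omega>)) (snd (probe_pair n d \<omega>)) (f (fst (probe_pair n d \<omega>))) (f (snd (probe_pair n d \<omega>)))}"
  shows "\<epsilon> / (144 * (real d * (real K + 1))) * real (card (probe_space n d K)) \<le> real (card G)"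
proof -
  let ?V = "hypergrid n d" and ?N = "nonerased (hypergrid n d) f"
  define f' where "f' = (\<lambda>x. case f x of None \<Rightarrow> 0 | Some s \<Rightarrow> s)"
  have res: "restoration ?V f f'" by (auto simp: restoration_def nonerased_def f'_def)
  define F where "F = (\<Sum>x\<in>?V. \<bar>f' x\<bar>)"
  \<comment> \<open>The margin \<open>2 * F\<close> dominates every difference of values of
    \<open>f'\<close> on the grid, so a pair at infinite distance does not exceed the finite
    substitute either.\<close>
  define b where "b = (\<Sum>r\<in>{1..d}. finite_part_sum n l u r) + 2 * F"
  define m where "m = grid_dist d (prefix_sum (cap_upper b u)) (prefix_sum (cap_lower b l))"
  have F0: "0 \<le> F" unfolding F_def by (intro sum_nonneg) simp
  then have b: "(\<Sum>r\<in>{1..d}. finite_part_sum n l u r) \<le> b" by (simp add: b_def)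
  have fF: "\<bar>f' x\<bar> \<le> F" if "x \<in> ?V" for x
    unfolding F_def using that finite_hypergrid by (intro member_le_sum) auto
  have dist: "bounding_dist d l u x y = ereal (m x y) \<or> bounding_dist d l u x y = \<infinity> \<and> 2 * F \<le> m x y"
    if "x \<in> ?V" "y \<in> ?V" for x y
    using bounding_dist_cap[OF B b that] by (simp add: m_def b_def)
  have NV: "?N \<subseteq> ?V" by (auto simp: nonerased_def)
  let ?v = "violated m f'"
  have "\<epsilon> * real (card ?V) \<le> 9 * real (\<Sum>r\<in>{1..d}. card (bad_points K ?N ?v r))"
    unfolding m_def
  proof (rule sum_card_bad_points[OF d n(2) NV _ \<epsilon> \<alpha>])
    show "cap_lower b l r t \<le> cap_upper b u r t" if "r \<in> {1..d}" "t \<in> {1..<n}" for r t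
      by (rule cap_lower_le_cap_upper[OF B that b])
    have "?V - ?N = {x\<in>?V. f x = None}" by (auto simp: nonerased_def)
    then show "real (card (?V - ?N)) \<le> \<alpha> * real (card ?V)" using er by (simp add: erased_def)
    fix g assume g: "\<And>x y. g x - g y \<le> grid_dist d (prefix_sum (cap_upper b u)) (prefix_sum (cap_lower b l)) x y"
    have "g \<in> bounded_derivative d l u ?V"
      unfolding bounded_derivative_def
    proof (intro CollectI ballI)
      fix x y assume "x \<in> ?V" "y \<in> ?V"
      then show "ereal (g x - g y) \<le> bounding_dist d l u x y"
        using dist[of x y] g[of x y] by (auto simp: m_def)
    qed
    then show "\<epsilon> * real (card ?N) \<le> real (card {x\<in>?N. f' x \<noteq> g x})"
      using far res by (auto simp: far_def)
  qed
  then have "2 ^ K * (\<epsilon> * real (card ?V)) \<le> 9 * (2 ^ K * real (\<Sum>r\<in>{1..d}. card (bad_points K ?N ?v r)))"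
    by simp
  also have "2 ^ K * real (\<Sum>r\<in>{1..d}. card (bad_points K ?N ?v r)) =
      real (2 ^ K * (\<Sum>r\<in>{1..d}. card (bad_points K ?N ?v r)))" by simp
  also have "\<dots> \<le> real (8 * card G)"
  proof (rule of_nat_mono)
    let ?p = "probe_pair n d"
    have "{\<omega>\<in>probe_space n d K. fst (?p \<omega>) \<in> ?N \<and> snd (?p \<omega>) \<in> ?N \<and> ?v (fst (?p \<omega>)) (snd (?p \<omega>))} \<subseteq> G"
    proof
      fix \<omega> assume \<omega>: "\<omega> \<in> {\<omega>\<in>probe_space n d K. fst (?p \<omega>) \<in> ?N \<and> snd (?p \<omega>) \<in> ?N \<and> ?v (fst (?p \<omega>)) (snd (?p \<omega>))}"
      define x y where "x = fst (?p \<omega>)" and "y = snd (?p \<omega>)"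
      have xy: "x \<in> ?N" "y \<in> ?N" "?v x y" using \<omega> by (simp_all add: x_def y_def)
      then have V: "x \<in> ?V" "y \<in> ?V" using NV by auto
      have fx: "f x = Some (f' x)" "f y = Some (f' y)" using xy res by (auto simp: restoration_def)
      have "\<not> (ereal (f' x - f' y) \<le> bounding_dist d l u x y \<and> ereal (f' y - f' x) \<le> bounding_dist d l u y x)"
        using xy(3) dist[OF V] dist[OF V(2,1)] fF[OF V(1)] fF[OF V(2)] by (auto simp: violated_def)
      then show "\<omega> \<in> G" using \<omega> fx by (auto simp: G_def conflict_def x_def y_def)
    qed
    then have "card {\<omega>\<in>probe_space n d K. fst (?p \<omega>) \<in> ?N \<and> snd (?p \<omega>) \<in> ?N \<and> ?v (fst (?p \<omega>)) (snd (?p \<omega>))} \<le> card G"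
      using finite_probe_space[of n d K] by (intro card_mono) (auto simp: G_def)
    then show "2 ^ K * (\<Sum>r\<in>{1..d}. card (bad_points K ?N ?v r)) \<le> 8 * card G"
      using card_detecting_probes[OF NV, of K ?v] by linarith
  qed
  finally have *: "2 ^ K * (\<epsilon> * real (card ?V)) \<le> 72 * real (card G)" by simp
  have "\<epsilon> / (144 * (real d * (real K + 1))) * real (card (probe_space n d K)) = 2 ^ K * (\<epsilon> * real (card ?V)) / 72"
  proof -
    define D where "D = real d * (real K + 1)"
    have "0 < D" using d by (simp add: D_def)
    moreover have "real (card (probe_space n d K)) = D * (2 * (2 ^ K * real (card ?V)))"
      by (simp add: card_probe_space D_def algebra_simps)
    ultimately show ?thesis unfolding D_def[symmetric] by simp
  qed
  then show ?thesis using * by linarith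
qed

text \<open>Restorable inputs are accepted with certainty because no probe can conflict. On far
  inputs each probe misses with probability at most \<open>1 - q\<close>, and the probes are
  independent.\<close>

lemma pair_tester_is_tester:
  fixes l u :: "nat \<Rightarrow> nat \<Rightarrow> ereal"
  defines "T \<equiv> \<lambda>n d K s. pair_tester (conflict (bounding_dist d l u)) (probe_pair n d) (probe_space n d K) s"
  assumes d: "1 \<le> d" and n: "1 \<le> n" "n \<le> 2 ^ K" and B: "bounding_family n d l u"
    and \<epsilon>: "0 < \<epsilon>" "\<epsilon> < 1" and \<alpha>: "\<alpha> \<le> \<epsilon> / (970 * real d)"
    and s: "288 * (real d * (real K + 1)) / \<epsilon> \<le> real s"
  shows "erasure_resilient_tester (hypergrid n d) (bounded_derivative d l u (hypergrid n d)) \<alpha> \<epsilon> (T n d K s)"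
    and "one_sided_error (hypergrid n d) (bounded_derivative d l u (hypergrid n d)) \<alpha> (T n d K s)"
    and "query_complexity_le (hypergrid n d) \<alpha> (T n d K s) (2 * real s)"
proof -
  let ?V = "hypergrid n d" and ?P = "bounded_derivative d l u (hypergrid n d)" and ?\<Omega> = "probe_space n d K"
  let ?T = "T n d K s"
  let ?c = "\<lambda>f \<omega>. conflict (bounding_dist d l u) (fst (probe_pair n d \<omega>)) (snd (probe_pair n d \<omega>))
    (f (fst (probe_pair n d \<omega>))) (f (snd (probe_pair n d \<omega>)))"
  have fin: "finite ?\<Omega>" by (rule finite_probe_space)
  have "(\<lambda>i\<in>{1..d}. 1) \<in> ?V" using n by (auto simp: hypergrid_def)
  then have "((\<lambda>i\<in>{1..d}. 1), 1, 0, True, 0) \<in> ?\<Omega>" using d by (simp add: probe_space_def)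
  then have ne: "?\<Omega> \<noteq> {}" by blast
  then have c0: "0 < real (card ?\<Omega>)" using fin by (simp add: card_gt_0_iff)
  have prob: "measure_pmf.prob ?T {A. accepts A f} = (real (card {\<omega>\<in>?\<Omega>. \<not> ?c f \<omega>}) / real (card ?\<Omega>)) ^ s" for f
    unfolding T_def by (rule prob_pair_tester_accepts[OF fin ne])
  have one: "measure_pmf.prob ?T {A. accepts A f} = 1" if "restorable ?V ?P f" for f
  proof -
    have "{\<omega>\<in>?\<Omega>. \<not> ?c f \<omega>} = ?\<Omega>"
      using restorable_no_conflict[OF that] probe_pair_in_hypergrid by blast
    then show ?thesis using c0 by (simp add: prob)
  qed
  then show "one_sided_error ?V ?P \<alpha> ?T" by (simp add: one_sided_error_def)
  have rej: "measure_pmf.prob ?T {A. \<not> accepts A f} \<ge> 2 / 3"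
    if er: "erased ?V \<alpha> f" and far: "far ?V ?P \<epsilon> f" for f
  proof -
    define q where "q = \<epsilon> / (144 * (real d * (real K + 1)))"
    have "card {\<omega>\<in>?\<Omega>. \<not> ?c f \<omega>} + card {\<omega>\<in>?\<Omega>. ?c f \<omega>} = card ({\<omega>\<in>?\<Omega>. \<not> ?c f \<omega>} \<union> {\<omega>\<in>?\<Omega>. ?c f \<omega>})"
      using fin by (intro card_Un_disjoint[symmetric]) auto
    also have "{\<omega>\<in>?\<Omega>. \<not> ?c f \<omega>} \<union> {\<omega>\<in>?\<Omega>. ?c f \<omega>} = ?\<Omega>" by blast
    finally have "real (card {\<omega>\<in>?\<Omega>. \<not> ?c f \<omega>}) \<le> (1 - q) * real (card ?\<Omega>)"
      using card_conflicting_probes[OF d n B \<epsilon> \<alpha> er far] by (simp add: q_def algebra_simps)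
    then have "real (card {\<omega>\<in>?\<Omega>. \<not> ?c f \<omega>}) / real (card ?\<Omega>) \<le> 1 - q"
      using c0 by (simp add: pos_divide_le_eq)
    also have "\<dots> \<le> exp (- q)" using exp_ge_add_one_self[of "- q"] by simp
    finally have "measure_pmf.prob ?T {A. accepts A f} \<le> exp (- q) ^ s"
      unfolding prob by (intro power_mono) auto
    also have "\<dots> = exp (- (q * real s))" by (simp add: exp_of_nat_mult[symmetric] mult.commute)
    \<comment> \<open>The 288 in the assumption on \<open>s\<close> is twice 144, so
      \<open>q * real s\<close> is at least 2.\<close>
    also have "\<dots> \<le> exp (- 2)"
    proof -
      define D where "D = real d * (real K + 1)"
      have "0 < D" using d by (simp add: D_def)
      then have "2 = q * (288 * (real d * (real K + 1)) / \<epsilon>)"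
        unfolding q_def D_def[symmetric] using \<epsilon> by simp
      also have "\<dots> \<le> q * real s" using s \<epsilon> by (intro mult_left_mono) (auto simp: q_def)
      finally show ?thesis by simp
    qed
    also have "\<dots> \<le> 1 / 3"
      using exp_ge_add_one_self[of 2] by (simp add: exp_minus field_simps)
    finally have "measure_pmf.prob ?T {A. accepts A f} \<le> 1 / 3" .
    moreover have "{A. \<not> accepts A f} = space (measure_pmf ?T) - {A. accepts A f}" by auto
    then have "measure_pmf.prob ?T {A. \<not> accepts A f} = 1 - measure_pmf.prob ?T {A. accepts A f}"
      using measure_pmf.prob_compl[of "{A. accepts A f}" ?T] by simp
    ultimately show ?thesis by simp
  qed
  show "erasure_resilient_tester ?V ?P \<alpha> \<epsilon> ?T"
    unfolding erasure_resilient_tester_def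
  proof (intro conjI ballI allI impI)
    fix A assume "A \<in> set_pmf ?T"
    then obtain \<omega>s where A: "A = pair_alg (conflict (bounding_dist d l u)) (map (probe_pair n d) \<omega>s)" "set \<omega>s \<subseteq> ?\<Omega>"
      unfolding T_def by (rule set_pair_tester[OF fin ne])
    have "query_points A \<subseteq> fst ` set (map (probe_pair n d) \<omega>s) \<union> snd ` set (map (probe_pair n d) \<omega>s)"
      unfolding A(1) by (rule query_points_pair_alg)
    also have "\<dots> \<subseteq> ?V"
    proof
      fix x assume "x \<in> fst ` set (map (probe_pair n d) \<omega>s) \<union> snd ` set (map (probe_pair n d) \<omega>s)"
      then obtain \<omega> where "\<omega> \<in> set \<omega>s" "x = fst (probe_pair n d \<omega>) \<or> x = snd (probe_pair n d \<omega>)"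
        unfolding set_map image_image by blast
      then show "x \<in> ?V" using A(2) probe_pair_in_hypergrid by blast
    qed
    finally show "query_points A \<subseteq> ?V" .
  next
    show "2 / 3 \<le> measure_pmf.prob ?T {A. accepts A f}" if "restorable ?V ?P f" for f
      using one[OF that] by simp
  qed (rule rej)
  show "query_complexity_le ?V \<alpha> ?T (2 * real s)"
    unfolding query_complexity_le_def
  proof (intro allI impI ballI)
    fix f A assume "A \<in> set_pmf ?T"
    then obtain \<omega>s where A: "A = pair_alg (conflict (bounding_dist d l u)) (map (probe_pair n d) \<omega>s)" "length \<omega>s = s"
      unfolding T_def by (rule set_pair_tester[OF fin ne])
    then show "real (num_queries A f) \<le> 2 * real s"
      using num_queries_pair_alg[of "conflict (bounding_dist d l u)" "map (probe_pair n d) \<omega>s" f] by simp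
  qed
qed

text \<open>For \<open>n = 1\<close> the query bound is \<open>0\<close>, and every function has the property.\<close>

lemma trivial_tester:
  assumes \<alpha>: "\<alpha> < 1" and \<epsilon>: "0 < \<epsilon>"
  shows "erasure_resilient_tester (hypergrid 1 d) (bounded_derivative d l u (hypergrid 1 d)) \<alpha> \<epsilon> (return_pmf (Decide True))"
proof -
  let ?V = "hypergrid 1 d" and ?P = "bounded_derivative d l u (hypergrid 1 d)"
  have V: "?V = {\<lambda>i\<in>{1..d}. 1}"
    by (auto simp: hypergrid_def PiE_iff extensional_def fun_eq_iff)
  have "\<not> far ?V ?P \<epsilon> f" if er: "erased ?V \<alpha> f" for f
  proof
    assume far: "far ?V ?P \<epsilon> f"
    define f' where "f' = (\<lambda>x. case f x of None \<Rightarrow> 0 | Some s \<Rightarrow> s)"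
    have "restoration ?V f f'" by (auto simp: restoration_def nonerased_def f'_def)
    moreover have "f' \<in> ?P" unfolding V by (simp add: bounded_derivative_def bounding_dist_def)
    ultimately have "\<epsilon> * real (card (nonerased ?V f)) \<le> 0"
      using far by (fastforce simp: far_def)
    then have "card (nonerased ?V f) = 0" using \<epsilon> by (simp add: mult_le_0_iff)
    moreover have "finite (nonerased ?V f)"
      using finite_hypergrid[of 1 d] by (simp add: nonerased_def)
    ultimately have "nonerased ?V f = {}" by simp
    \<comment> \<open>The single grid point would be erased, which an erasure fraction
      \<open>\<alpha> < 1\<close> forbids.\<close>
    then have "{x\<in>?V. f x = None} = ?V" by (auto simp: nonerased_def)
    moreover have "card ?V = 1" unfolding V by simp
    ultimately show False using er \<alpha> by (simp only: erased_def)
  qed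
  then show ?thesis by (auto simp: erasure_resilient_tester_def)
qed

theorem theorem1p5:
  "\<exists>C::real. C > 0 \<and>
     (\<forall>(n::nat) (d::nat) (P :: ((nat \<Rightarrow> nat) \<Rightarrow> real) set).
        n \<ge> 1 \<longrightarrow> d \<ge> 1 \<longrightarrow> bounded_derivative_property n d P \<longrightarrow>
        (\<exists>T :: real \<Rightarrow> real \<Rightarrow> (nat \<Rightarrow> nat) query_alg pmf.
           \<forall>\<alpha> \<epsilon>. 0 < \<alpha> \<longrightarrow> \<alpha> < 1 \<longrightarrow> 0 < \<epsilon> \<longrightarrow> \<epsilon> < 1 \<longrightarrow> \<alpha> \<le> \<epsilon> / (970 * real d) \<longrightarrow>
             erasure_resilient_tester (hypergrid n d) P \<alpha> \<epsilon> (T \<alpha> \<epsilon>) \<and>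
             one_sided_error (hypergrid n d) P \<alpha> (T \<alpha> \<epsilon>) \<and>
             query_complexity_le (hypergrid n d) \<alpha> (T \<alpha> \<epsilon>)
               (C * (real d * log 2 (real n) / (\<epsilon> * (1 - \<alpha>))))))"
proof (intro exI[of _ 1730] conjI allI impI)
  fix n d :: nat and P :: "((nat \<Rightarrow> nat) \<Rightarrow> real) set"
  assume n: "n \<ge> 1" and d: "d \<ge> 1" and "bounded_derivative_property n d P"
  then obtain l u where B: "bounding_family n d l u" and P: "P = bounded_derivative d l u (hypergrid n d)"
    by (auto simp: bounded_derivative_property_def)
  show "\<exists>T :: real \<Rightarrow> real \<Rightarrow> (nat \<Rightarrow> nat) query_alg pmf.
       \<forall>\<alpha> \<epsilon>. 0 < \<alpha> \<longrightarrow> \<alpha> < 1 \<longrightarrow> 0 < \<epsilon> \<longrightarrow> \<epsilon> < 1 \<longrightarrow> \<alpha> \<le> \<epsilon> / (970 * real d) \<longrightarrow>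
         erasure_resilient_tester (hypergrid n d) P \<alpha> \<epsilon> (T \<alpha> \<epsilon>) \<and>
         one_sided_error (hypergrid n d) P \<alpha> (T \<alpha> \<epsilon>) \<and>
         query_complexity_le (hypergrid n d) \<alpha> (T \<alpha> \<epsilon>)
           (1730 * (real d * log 2 (real n) / (\<epsilon> * (1 - \<alpha>))))"
  proof (cases "n = 1")
    case True
    then show ?thesis
      using trivial_tester[of _ _ d l u]
      by (intro exI[of _ "\<lambda>_ _. return_pmf (Decide True)"])
        (auto simp: P one_sided_error_def query_complexity_le_def)
  next
    case False
    then have n2: "2 \<le> n" using n by simp
    \<comment> \<open>The scales up to \<open>2 ^ K\<close> cover a line of length \<open>n\<close>,
      and there are only logarithmically many of them.\<close>
    define K where "K = nat \<lceil>log 2 (real n)\<rceil>"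
    have log1: "1 \<le> log 2 (real n)" using n2 by (simp add: le_log_iff)
    have K: "log 2 (real n) \<le> real K" "real K \<le> log 2 (real n) + 1"
      using log1 unfolding K_def by linarith+
    have "real n = 2 powr (log 2 (real n))" using n by simp
    also have "\<dots> \<le> 2 powr (real K)" using K by (intro powr_mono) auto
    also have "\<dots> = real (2 ^ K)" by (simp add: powr_realpow)
    finally have nK: "n \<le> 2 ^ K" by (simp only: of_nat_le_iff)
    define s where "s = (\<lambda>\<epsilon>::real. nat \<lceil>288 * (real d * (real K + 1)) / \<epsilon>\<rceil>)"
    let ?T = "\<lambda>(\<alpha>::real) \<epsilon>. pair_tester (conflict (bounding_dist d l u)) (probe_pair n d) (probe_space n d K) (s \<epsilon>)"
    show ?thesis
    proof (intro exI[of _ ?T] allI impI)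
      fix \<alpha> \<epsilon> :: real
      assume \<alpha>: "0 < \<alpha>" "\<alpha> < 1" and \<epsilon>: "0 < \<epsilon>" "\<epsilon> < 1" and le: "\<alpha> \<le> \<epsilon> / (970 * real d)"
      have s: "288 * (real d * (real K + 1)) / \<epsilon> \<le> real (s \<epsilon>)" unfolding s_def by linarith
      note T = pair_tester_is_tester[OF d n nK B \<epsilon> le s]
      \<comment> \<open>As \<open>log 2 n \<ge> 1\<close>, \<open>K + 1\<close> is at most
        \<open>3 * log 2 n\<close>, so \<open>s \<epsilon>\<close> is at most
        \<open>864 * X + 1\<close>; doubling for the two queries of a probe and using
        \<open>X \<ge> 1\<close> gives 1730. Dividing by \<open>1 - \<alpha>\<close> only enlarges
        the bound.\<close>
      have "2 * real (s \<epsilon>) \<le> 1730 * (real d * log 2 (real n) / (\<epsilon> * (1 - \<alpha>)))"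
      proof -
        define X where "X = real d * log 2 (real n) / \<epsilon>"
        have "1 * 1 \<le> real d * log 2 (real n)" using d log1 by (intro mult_mono) auto
        then have X1: "1 \<le> X" using \<epsilon> by (simp add: X_def le_divide_eq)
        have "0 \<le> 288 * (real d * (real K + 1)) / \<epsilon>" using \<epsilon> by simp
        then have "real (s \<epsilon>) \<le> 288 * (real d * (real K + 1)) / \<epsilon> + 1" unfolding s_def by linarith
        also have "288 * (real d * (real K + 1)) / \<epsilon> \<le> 288 * (real d * (3 * log 2 (real n))) / \<epsilon>"
          using K log1 \<epsilon> by (intro divide_right_mono mult_left_mono) auto
        also have "\<dots> = 864 * X" by (simp add: X_def)
        finally have "2 * real (s \<epsilon>) \<le> 1730 * X" using X1 by simp
        also have "X \<le> X / (1 - \<alpha>)" using X1 \<alpha> by (simp add: le_divide_eq mult_left_le)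
        also have "X / (1 - \<alpha>) = real d * log 2 (real n) / (\<epsilon> * (1 - \<alpha>))" by (simp add: X_def)
        finally show ?thesis by simp
      qed
      then have "query_complexity_le (hypergrid n d) \<alpha> (?T \<alpha> \<epsilon>)
          (1730 * (real d * log 2 (real n) / (\<epsilon> * (1 - \<alpha>))))"
        using T(3) unfolding query_complexity_le_def by force
      with T(1,2) show "erasure_resilient_tester (hypergrid n d) P \<alpha> \<epsilon> (?T \<alpha> \<epsilon>) \<and>
          one_sided_error (hypergrid n d) P \<alpha> (?T \<alpha> \<epsilon>) \<and>
          query_complexity_le (hypergrid n d) \<alpha> (?T \<alpha> \<epsilon>)
            (1730 * (real d * log 2 (real n) / (\<epsilon> * (1 - \<alpha>))))"
        by (simp add: P)
    qed
  qed
qed simp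

end
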